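(* If one of the problems Check, Boole, or Witness can be solved (by a combinatorial algorithm) in time $O(|V_{\mathcal D}|^{3-\epsilon}+|q|^{3-\epsilon})$ for some $\epsilon>0$, then the combinatorial BMM-hypothesis fails.
   Context: $\Sigma$ is a fixed finite alphabet of constant size. A graph database over $\Sigma$ is a pair $\mathcal{D}=(V_{\mathcal D},E_{\mathcal D})$ with a finite node set and arc set $E_{\mathcal D}\subseteq V_{\mathcal D}\times\Sigma\times V_{\mathcal D}$, represented by adjacency lists. A path from $u$ to $v$ is a sequence $u=w_0,a_1,w_1,\dots,a_k,w_k=v$ ($k\ge0$) with $(w_{i-1},a_i,w_i)\in E_{\mathcal D}$, labelled by $a_1\cdots a_k$. An RPQ $q$ is a regular expression over $\Sigma$ (built from $\varepsilon$, letters, concatenation, alternation, Kleene plus), $|q|$ its length; $q(\mathcal D)$ is the set of node pairs $(u,v)$ such that some path from $u$ to $v$ is labelled by a word in the language of $q$. Problems: Boole (decide $q(\mathcal D)\ne\emptyset$); Check (given also $u,v$, decide $(u,v)\in q(\mathcal D)$); Witness (output some element of $q(\mathcal D)$ or report none exists). Model: RAM with logarithmic word size. Boolean matrix multiplication (BMM): given Boolean $n\times n$ matrices $A,B$, compute $A\times B$. Combinatorial BMM-hypothesis: for every $\epsilon>0$ there is no combinatorial algorithm solving BMM in time $O(n^{3-\epsilon})$ ("combinatorial" is the informal notion of an algorithm not relying on algebraic fast matrix multiplication techniques).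
   Formalization: The alphabet is assumed to have at least two letters (over one letter Boole and Witness are solvable in linear time), and "combinatorial" is any class of RAM programs closed under the explicit block-search reduction. *)

theory Defs
  imports Complex_Main
begin

section \<open>Graph databases and regular path queries\<close>

type_synonym ('v, 'a) graph_db = "'v set \<times> ('v \<times> 'a \<times> 'v) set"

definition nodes :: "('v, 'a) graph_db \<Rightarrow> 'v set" where
  "nodes D = fst D"

definition arcs :: "('v, 'a) graph_db \<Rightarrow> ('v \<times> 'a \<times> 'v) set" where
  "arcs D = snd D"

definition graph_db_over :: "'a set \<Rightarrow> ('v, 'a) graph_db \<Rightarrow> bool" where
  "graph_db_over \<Sigma> D \<longleftrightarrow> finite (nodes D) \<and> arcs D \<subseteq> nodes D \<times> \<Sigma> \<times> nodes D"

inductive labelled_path :: "('v, 'a) graph_db \<Rightarrow> 'v \<Rightarrow> 'a list \<Rightarrow> 'v \<Rightarrow> bool" for D where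
  empty: "u \<in> nodes D \<Longrightarrow> labelled_path D u [] u"
| step: "(u, a, w) \<in> arcs D \<Longrightarrow> labelled_path D w as v \<Longrightarrow> labelled_path D u (a # as) v"

datatype 'a rpq =
    Eps
  | Letter 'a
  | Concat "'a rpq" "'a rpq"
  | Alt "'a rpq" "'a rpq"
  | Plus "'a rpq"

fun lang :: "'a rpq \<Rightarrow> 'a list set" where
  "lang Eps = {[]}"
| "lang (Letter a) = {[a]}"
| "lang (Concat r s) = {x @ y | x y. x \<in> lang r \<and> y \<in> lang s}"
| "lang (Alt r s) = lang r \<union> lang s"
| "lang (Plus r) = {concat ws | ws. ws \<noteq> [] \<and> set ws \<subseteq> lang r}"

text \<open>The length of a query counts the occurrences of letters, of epsilon and of operators.\<close>

fun rpq_length :: "'a rpq \<Rightarrow> nat" where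
  "rpq_length Eps = 1"
| "rpq_length (Letter a) = 1"
| "rpq_length (Concat r s) = 1 + rpq_length r + rpq_length s"
| "rpq_length (Alt r s) = 1 + rpq_length r + rpq_length s"
| "rpq_length (Plus r) = 1 + rpq_length r"

definition rpq_over :: "'a set \<Rightarrow> 'a rpq \<Rightarrow> bool" where
  "rpq_over \<Sigma> q \<longleftrightarrow> set_rpq q \<subseteq> \<Sigma>"

definition answers :: "'a rpq \<Rightarrow> ('v, 'a) graph_db \<Rightarrow> ('v \<times> 'v) set" where
  "answers q D = {(u, v). \<exists>w \<in> lang q. labelled_path D u w v}"


section \<open>Random access machines\<close>

text \<open>
  RAM programs are given in structured form: finitely many registers, accessed by name, and an
  indirectly addressed memory of words. Every operation costs one unit of time. A parameter \<open>W\<close>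
  bounds the words: a run during which an address or a computed value reaches \<open>W\<close> does not count
  as an execution.
\<close>

datatype bop = Add | Sub | Mul | Div | Mod | Less | Equal | BitAnd | BitOr | BitXor | Shl | Shr

datatype exp = Num nat | Var string | Mem exp | Op bop exp exp

datatype com =
    Skip
  | Assign string exp  (\<open>_ ::= _\<close> [1000, 61] 61)
  | Store exp exp
  | Seq com com  (infixr \<open>;;\<close> 60)
  | If exp com com
  | While exp com
  | Call com exp exp exp exp

type_synonym state = "(string \<Rightarrow> nat) \<times> (nat \<Rightarrow> nat)"

fun apply_bop :: "bop \<Rightarrow> nat \<Rightarrow> nat \<Rightarrow> nat" where
  "apply_bop Add x y = x + y"
| "apply_bop Sub x y = x - y"
| "apply_bop Mul x y = x * y"
| "apply_bop Div x y = x div y"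
| "apply_bop Mod x y = x mod y"
| "apply_bop Less x y = of_bool (x < y)"
| "apply_bop Equal x y = of_bool (x = y)"
| "apply_bop BitAnd x y = and x y"
| "apply_bop BitOr x y = or x y"
| "apply_bop BitXor x y = xor x y"
| "apply_bop Shl x y = push_bit y x"
| "apply_bop Shr x y = drop_bit y x"

fun val :: "exp \<Rightarrow> state \<Rightarrow> nat" where
  "val (Num k) s = k"
| "val (Var x) s = fst s x"
| "val (Mem e) s = snd s (val e s)"
| "val (Op f e1 e2) s = apply_bop f (val e1 s) (val e2 s)"

fun cost :: "exp \<Rightarrow> nat" where
  "cost (Num k) = 1"
| "cost (Var x) = 1"
| "cost (Mem e) = 1 + cost e"
| "cost (Op f e1 e2) = 1 + cost e1 + cost e2"

fun fits :: "nat \<Rightarrow> exp \<Rightarrow> state \<Rightarrow> bool" where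
  "fits W (Num k) s \<longleftrightarrow> k < W"
| "fits W (Var x) s \<longleftrightarrow> fst s x < W"
| "fits W (Mem e) s \<longleftrightarrow> fits W e s \<and> snd s (val e s) < W"
| "fits W (Op f e1 e2) s \<longleftrightarrow>
     fits W e1 s \<and> fits W e2 s \<and> apply_bop f (val e1 s) (val e2 s) < W"

text \<open>
  \<open>exec W c s t s'\<close>: with words below \<open>W\<close>, program \<open>c\<close> started in \<open>s\<close> terminates in \<open>s'\<close> after \<open>t\<close>
  steps. \<open>Call P a l b k\<close> runs the subroutine \<open>P\<close> in a private, zero-initialised store whose first
  \<open>l\<close> memory words are copied from address \<open>a\<close> on, and then copies the first \<open>k\<close> memory words left
  by \<open>P\<close> to address \<open>b\<close> on; the time for copying both ways is charged.
\<close>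

inductive exec :: "nat \<Rightarrow> com \<Rightarrow> state \<Rightarrow> nat \<Rightarrow> state \<Rightarrow> bool" for W where
  Skip: "exec W Skip s 1 s"
| Assign: "fits W e s \<Longrightarrow>
    exec W (x ::= e) s (1 + cost e) ((fst s)(x := val e s), snd s)"
| Store: "fits W a s \<Longrightarrow> fits W e s \<Longrightarrow>
    exec W (Store a e) s (1 + cost a + cost e) (fst s, (snd s)(val a s := val e s))"
| Seq: "exec W c1 s t1 s' \<Longrightarrow> exec W c2 s' t2 s'' \<Longrightarrow> exec W (c1 ;; c2) s (t1 + t2) s''"
| IfTrue: "fits W e s \<Longrightarrow> val e s \<noteq> 0 \<Longrightarrow> exec W c1 s t s' \<Longrightarrow>
    exec W (If e c1 c2) s (1 + cost e + t) s'"
| IfFalse: "fits W e s \<Longrightarrow> val e s = 0 \<Longrightarrow> exec W c2 s t s' \<Longrightarrow>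
    exec W (If e c1 c2) s (1 + cost e + t) s'"
| WhileFalse: "fits W e s \<Longrightarrow> val e s = 0 \<Longrightarrow> exec W (While e c) s (1 + cost e) s"
| WhileTrue: "fits W e s \<Longrightarrow> val e s \<noteq> 0 \<Longrightarrow> exec W c s t1 s' \<Longrightarrow> exec W (While e c) s' t2 s'' \<Longrightarrow>
    exec W (While e c) s (1 + cost e + t1 + t2) s''"
| Call: "fits W a s \<Longrightarrow> fits W l s \<Longrightarrow> fits W b s \<Longrightarrow> fits W k s \<Longrightarrow>
    val a s + val l s \<le> W \<Longrightarrow> val b s + val k s \<le> W \<Longrightarrow>
    exec W P (\<lambda>_. 0, \<lambda>i. if i < val l s then snd s (val a s + i) else 0) t s' \<Longrightarrow>
    exec W (Call P a l b k) s (1 + cost a + cost l + cost b + cost k + val l s + val k s + t)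
      (fst s, \<lambda>i. if val b s \<le> i \<and> i < val b s + val k s then snd s' (i - val b s) else snd s i)"

definition initial_state :: "nat list \<Rightarrow> state" where
  "initial_state xs = (\<lambda>_. 0, \<lambda>i. if i < length xs then xs ! i else 0)"

text \<open>
  A problem relates every instance to the word sequences representing it and to the final
  memory contents that count as a correct output.
\<close>

record 'i problem =
  instances :: "'i set"
  encodes :: "'i \<Rightarrow> nat list \<Rightarrow> bool"
  correct :: "'i \<Rightarrow> (nat \<Rightarrow> nat) \<Rightarrow> bool"

text \<open>
  \<open>P\<close> solves \<open>\<Pi>\<close> in time \<open>O(T)\<close>. The word bound \<open>(N + 2) ^ c\<close> for inputs of \<open>N\<close> words expresses that
  words have \<open>O(log N)\<close> bits.
\<close>

definition solves_in_time :: "com \<Rightarrow> 'i problem \<Rightarrow> ('i \<Rightarrow> real) \<Rightarrow> bool" where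
  "solves_in_time P \<Pi> T \<longleftrightarrow>
     (\<exists>c::nat. \<forall>x \<in> instances \<Pi>. \<forall>xs. encodes \<Pi> x xs \<longrightarrow>
        (\<exists>t s. exec ((length xs + 2) ^ c) P (initial_state xs) t s \<and>
               real t \<le> real c * T x \<and> correct \<Pi> x (snd s)))"


section \<open>The problems\<close>

text \<open>
  The alphabet with \<open>\<sigma>\<close> letters is \<open>{..<\<sigma>}\<close>, and the nodes of an input database are numbered
  from \<open>0\<close>.
\<close>

definition db_instance :: "nat \<Rightarrow> (nat, nat) graph_db \<Rightarrow> bool" where
  "db_instance \<sigma> D \<longleftrightarrow> graph_db_over {..<\<sigma>} D \<and> nodes D = {..<card (nodes D)}"

text \<open>
  Adjacency lists, stored one after the other as (letter, target) pairs, and preceded by the number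
  of nodes and a table with the position of the first entry of each list (and, last, the total
  number of entries). The order within each list is arbitrary.
\<close>

definition adjacency_words :: "(nat \<times> nat) list list \<Rightarrow> nat list" where
  "adjacency_words adj =
     length adj # map (\<lambda>u. length (concat (take u adj))) [0..<Suc (length adj)]
       @ concat (map (\<lambda>(a, v). [a, v]) (concat adj))"

definition encodes_db :: "(nat, nat) graph_db \<Rightarrow> nat list \<Rightarrow> bool" where
  "encodes_db D xs \<longleftrightarrow>
     (\<exists>adj. length adj = card (nodes D) \<and>
            (\<forall>u < length adj. distinct (adj ! u) \<and> set (adj ! u) = {(a, v). (u, a, v) \<in> arcs D}) \<and>
            xs = adjacency_words adj)"

text \<open>Queries are stored in prefix notation.\<close>

fun rpq_words :: "nat rpq \<Rightarrow> nat list" where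
  "rpq_words Eps = [0]"
| "rpq_words (Letter a) = [4 + a]"
| "rpq_words (Concat r s) = 1 # rpq_words r @ rpq_words s"
| "rpq_words (Alt r s) = 2 # rpq_words r @ rpq_words s"
| "rpq_words (Plus r) = 3 # rpq_words r"

definition boole_problem :: "nat \<Rightarrow> ((nat, nat) graph_db \<times> nat rpq) problem" where
  "boole_problem \<sigma> =
     \<lparr> instances = {(D, q). db_instance \<sigma> D \<and> rpq_over {..<\<sigma>} q},
       encodes = (\<lambda>(D, q) xs. \<exists>ys. encodes_db D ys \<and> xs = ys @ rpq_words q),
       correct = (\<lambda>(D, q) m. m 0 = of_bool (answers q D \<noteq> {})) \<rparr>"

definition check_problem :: "nat \<Rightarrow> ((nat, nat) graph_db \<times> nat rpq \<times> nat \<times> nat) problem" where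
  "check_problem \<sigma> =
     \<lparr> instances = {(D, q, u, v). db_instance \<sigma> D \<and> rpq_over {..<\<sigma>} q \<and> u \<in> nodes D \<and> v \<in> nodes D},
       encodes = (\<lambda>(D, q, u, v) xs. \<exists>ys. encodes_db D ys \<and> xs = u # v # ys @ rpq_words q),
       correct = (\<lambda>(D, q, u, v) m. m 0 = of_bool ((u, v) \<in> answers q D)) \<rparr>"

definition witness_problem :: "nat \<Rightarrow> ((nat, nat) graph_db \<times> nat rpq) problem" where
  "witness_problem \<sigma> =
     \<lparr> instances = {(D, q). db_instance \<sigma> D \<and> rpq_over {..<\<sigma>} q},
       encodes = (\<lambda>(D, q) xs. \<exists>ys. encodes_db D ys \<and> xs = ys @ rpq_words q),
       correct = (\<lambda>(D, q) m. if answers q D = {} then m 0 = 0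
                              else m 0 = 1 \<and> (m 1, m 2) \<in> answers q D) \<rparr>"

definition bmm_problem :: "(nat \<times> (nat \<Rightarrow> nat \<Rightarrow> bool) \<times> (nat \<Rightarrow> nat \<Rightarrow> bool)) problem" where
  "bmm_problem =
     \<lparr> instances = {(n, A, B). 1 \<le> n},
       encodes = (\<lambda>(n, A, B) xs.
         xs = n # concat (map (\<lambda>i. map (\<lambda>j. of_bool (A i j)) [0..<n]) [0..<n])
                @ concat (map (\<lambda>i. map (\<lambda>j. of_bool (B i j)) [0..<n]) [0..<n])),
       correct = (\<lambda>(n, A, B) m.
         \<forall>i < n. \<forall>j < n. m (i * n + j) = of_bool (\<exists>k < n. A i k \<and> B k j)) \<rparr>"

definition combinatorial_BMM_hypothesis :: "(com \<Rightarrow> bool) \<Rightarrow> bool" where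
  "combinatorial_BMM_hypothesis comb \<longleftrightarrow>
     (\<forall>\<epsilon>>0. \<not> (\<exists>P. comb P \<and> solves_in_time P bmm_problem (\<lambda>(n, A, B). real n powr (3 - \<epsilon>))))"


section \<open>Combinatorial algorithms\<close>

text \<open>
  "Combinatorial" has no formal definition, so it is modelled by an arbitrary class of programs.
  The one thing required of the class is that using a combinatorial algorithm \<open>P\<close> as a subroutine
  in the program \<open>block_search\<close> below, which uses matrix entries only in Boolean tests (products
  of truth values are conjunctions), gives a combinatorial algorithm again. Closure under arbitrary programs that call \<open>P\<close> would be far too
  strong: such programs can also ignore \<open>P\<close> and use fast matrix multiplication.

  \<open>block_search\<close> divides the index range of the \<open>n \<times> n\<close> matrices \<open>A\<close> and \<open>B\<close> into blocks of size
  \<open>s\<close>, about the fourth root of \<open>n\<close>. For each triple of blocks \<open>I\<close>, \<open>K\<close>, \<open>J\<close> it writes down a graph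
  database and a query, calls \<open>P\<close>, and if the first word of the answer is not \<open>0\<close>, it goes through all
  \<open>i\<close>, \<open>k\<close>, \<open>j\<close> in these blocks and sets \<open>C i j\<close> whenever \<open>A i k\<close> and \<open>B k j\<close>.
\<close>

abbreviation plus_exp (infixl \<open>\<^bold>+\<close> 65) where "e1 \<^bold>+ e2 \<equiv> Op Add e1 e2"
abbreviation minus_exp (infixl \<open>\<^bold>-\<close> 65) where "e1 \<^bold>- e2 \<equiv> Op Sub e1 e2"
abbreviation times_exp (infixl \<open>\<^bold>*\<close> 70) where "e1 \<^bold>* e2 \<equiv> Op Mul e1 e2"
abbreviation less_exp (infix \<open>\<^bold><\<close> 50) where "e1 \<^bold>< e2 \<equiv> Op Less e1 e2"
abbreviation equal_exp (infix \<open>\<^bold>=\<close> 50) where "e1 \<^bold>= e2 \<equiv> Op Equal e1 e2"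

definition For :: "string \<Rightarrow> exp \<Rightarrow> com \<Rightarrow> com" where
  "For x e c = (x ::= Num 0 ;; While (Var x \<^bold>< e) (c ;; x ::= Var x \<^bold>+ Num 1))"

abbreviation "vn \<equiv> Var ''n''"
abbreviation "vs \<equiv> Var ''s''"
abbreviation "vd \<equiv> Var ''d''"
abbreviation "vp \<equiv> Var ''p''"

text \<open>Memory: \<open>n\<close>, the matrices \<open>A\<close>, \<open>B\<close>, \<open>C\<close>, and from address \<open>d\<close> on the input for \<open>P\<close>.\<close>

definition A_at :: "exp \<Rightarrow> exp \<Rightarrow> exp" where
  "A_at i k = Num 1 \<^bold>+ i \<^bold>* vn \<^bold>+ k"

definition B_at :: "exp \<Rightarrow> exp \<Rightarrow> exp" where
  "B_at k j = Num 1 \<^bold>+ vn \<^bold>* vn \<^bold>+ k \<^bold>* vn \<^bold>+ j"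

definition C_at :: "exp \<Rightarrow> exp \<Rightarrow> exp" where
  "C_at i j = Num 1 \<^bold>+ Num 2 \<^bold>* vn \<^bold>* vn \<^bold>+ i \<^bold>* vn \<^bold>+ j"

definition in_block :: "string \<Rightarrow> exp \<Rightarrow> exp" where
  "in_block X x = Var X \<^bold>* vs \<^bold>+ x"

text \<open>
  The database has nodes \<open>0, \<dots>, 4s+1\<close>. Nodes \<open>0, \<dots>, s-1\<close> stand for the \<open>i\<close> in block \<open>I\<close>, the next
  \<open>s\<close> for the \<open>k\<close> in \<open>K\<close>, the next \<open>s\<close> for the \<open>j\<close> in \<open>J\<close>, and the next \<open>s\<close> for the \<open>i\<close> in \<open>I\<close> again.
  Arcs with letter 1 connect these layers where \<open>A i k\<close>, \<open>B k j\<close>, and \<open>\<not> C i j\<close>, respectively. The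
  first layer is a chain of arcs with letter 0, entered at its first node from node \<open>4s\<close>, and the
  last layer is the reverse chain, left from its last node to node \<open>4s+1\<close>.
\<close>

definition arc_0 :: "exp \<Rightarrow> exp \<Rightarrow> exp" where
  "arc_0 u v =
     (u \<^bold>+ Num 1 \<^bold>= v) \<^bold>* (v \<^bold>< vs)
     \<^bold>+ (v \<^bold>+ Num 1 \<^bold>= u) \<^bold>* (Num 3 \<^bold>* vs \<^bold>< v \<^bold>+ Num 1) \<^bold>* (u \<^bold>< Num 4 \<^bold>* vs)"

definition layer_to_next :: "nat \<Rightarrow> exp \<Rightarrow> exp \<Rightarrow> exp" where
  "layer_to_next l u v =
     (Num l \<^bold>* vs \<^bold>< u \<^bold>+ Num 1) \<^bold>* (u \<^bold>< Num (l + 1) \<^bold>* vs) \<^bold>*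
     (Num (l + 1) \<^bold>* vs \<^bold>< v \<^bold>+ Num 1) \<^bold>* (v \<^bold>< Num (l + 2) \<^bold>* vs)"

definition arc_1 :: "exp \<Rightarrow> exp \<Rightarrow> exp" where
  "arc_1 u v =
     (let i = in_block ''I'' u; k = in_block ''K'' (v \<^bold>- vs) in
        layer_to_next 0 u v \<^bold>* (i \<^bold>< vn) \<^bold>* (k \<^bold>< vn) \<^bold>* Mem (A_at i k))
     \<^bold>+
     (let k = in_block ''K'' (u \<^bold>- vs); j = in_block ''J'' (v \<^bold>- Num 2 \<^bold>* vs) in
        layer_to_next 1 u v \<^bold>* (k \<^bold>< vn) \<^bold>* (j \<^bold>< vn) \<^bold>* Mem (B_at k j))
     \<^bold>+
     (let j = in_block ''J'' (u \<^bold>- Num 2 \<^bold>* vs); i = in_block ''I'' (v \<^bold>- Num 3 \<^bold>* vs) in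
        layer_to_next 2 u v \<^bold>* (j \<^bold>< vn) \<^bold>* (i \<^bold>< vn) \<^bold>* (Num 1 \<^bold>- Mem (C_at i j)))
     \<^bold>+ (u \<^bold>= Num 4 \<^bold>* vs) \<^bold>* (v \<^bold>= Num 0)
     \<^bold>+ (u \<^bold>= Num 3 \<^bold>* vs) \<^bold>* (v \<^bold>= Num 4 \<^bold>* vs \<^bold>+ Num 1)"

definition emit :: "exp \<Rightarrow> com" where
  "emit e = (Store vp e ;; ''p'' ::= vp \<^bold>+ Num 1)"

definition emit_arc :: "nat \<Rightarrow> com" where
  "emit_arc a = (emit (Num a) ;; emit (Var ''v'') ;; ''e'' ::= Var ''e'' \<^bold>+ Num 1)"

text \<open>The two words before the database are the pair of nodes for Check.\<close>

definition write_db :: com where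
  "write_db =
     (Store vd (Num 4 \<^bold>* vs) ;;
      Store (vd \<^bold>+ Num 1) (Num 4 \<^bold>* vs \<^bold>+ Num 1) ;;
      Store (vd \<^bold>+ Num 2) (Num 4 \<^bold>* vs \<^bold>+ Num 2) ;;
      ''p'' ::= vd \<^bold>+ Num 4 \<^bold>* vs \<^bold>+ Num 6 ;;
      ''e'' ::= Num 0 ;;
      For ''u'' (Num 4 \<^bold>* vs \<^bold>+ Num 2)
        (Store (vd \<^bold>+ Num 3 \<^bold>+ Var ''u'') (Var ''e'') ;;
         For ''v'' (Num 4 \<^bold>* vs \<^bold>+ Num 2)
           (If (arc_0 (Var ''u'') (Var ''v'')) (emit_arc 0) Skip ;;
            If (arc_1 (Var ''u'') (Var ''v'')) (emit_arc 1) Skip)) ;;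
      Store (vd \<^bold>+ Num 4 \<^bold>* vs \<^bold>+ Num 5) (Var ''e''))"

text \<open>
  With \<open>a\<close> and \<open>b\<close> for the letters 0 and 1, the query is \<open>b F b\<close>, where \<open>F\<close> is the \<open>s\<close>-fold nested
  expression \<open>bbb | a(bbb | a(\<dots>(bbb)\<dots>)a)a\<close>.
\<close>

definition write_query :: com where
  "write_query =
     (emit (Num 1) ;; emit (Num 5) ;; emit (Num 1) ;;
      For ''u'' vs
        (emit (Num 2) ;;
         emit (Num 1) ;; emit (Num 5) ;; emit (Num 1) ;; emit (Num 5) ;; emit (Num 5) ;;
         emit (Num 1) ;; emit (Num 4) ;; emit (Num 1)) ;;
      emit (Num 1) ;; emit (Num 5) ;; emit (Num 1) ;; emit (Num 5) ;; emit (Num 5) ;;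
      For ''u'' vs (emit (Num 4)) ;;
      emit (Num 5))"

definition search_block :: com where
  "search_block =
     For ''u'' vs (For ''v'' vs (For ''w'' vs
       (let i = in_block ''I'' (Var ''u''); k = in_block ''K'' (Var ''v'');
            j = in_block ''J'' (Var ''w'') in
          If ((i \<^bold>< vn) \<^bold>* (k \<^bold>< vn) \<^bold>* (j \<^bold>< vn) \<^bold>* Mem (A_at i k) \<^bold>* Mem (B_at k j))
            (Store (C_at i j) (Num 1)) Skip)))"

text \<open>
  If \<open>with_nodes\<close>, then \<open>P\<close> is called with the pair of nodes, the database and the query, otherwise
  with the database and the query only.
\<close>

definition block_search :: "bool \<Rightarrow> com \<Rightarrow> com" where
  "block_search with_nodes P =
     (let start = vd \<^bold>+ Num (if with_nodes then 0 else 2);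
          blocks = Op Div vn vs \<^bold>+ Num 1;
          s' = vs \<^bold>+ Num 1 in
      ''n'' ::= Mem (Num 0) ;;
      ''s'' ::= Num 1 ;;
      While ((s' \<^bold>* s') \<^bold>* (s' \<^bold>* s') \<^bold>< vn \<^bold>+ Num 1) (''s'' ::= s') ;;
      ''d'' ::= Num 1 \<^bold>+ Num 3 \<^bold>* vn \<^bold>* vn ;;
      For ''I'' blocks (For ''K'' blocks (For ''J'' blocks
        (write_db ;;
         write_query ;;
         Call P start (vp \<^bold>- start) vd (Num 1) ;;
         If (Mem vd) search_block Skip))) ;;
      For ''u'' (vn \<^bold>* vn) (Store (Var ''u'') (Mem (C_at (Num 0) (Var ''u'')))))"

definition admissible_combinatorial :: "(com \<Rightarrow> bool) \<Rightarrow> bool" where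
  "admissible_combinatorial comb \<longleftrightarrow>
     (\<forall>P with_nodes. comb P \<longrightarrow> comb (block_search with_nodes P))"

end

theory Submission
  imports Defs
begin

text \<open>
  Every path of the database for the blocks \<open>I\<close>, \<open>K\<close>, \<open>J\<close> that is labelled by a word
  \<open>b a\<^sup>m bbb a\<^sup>m b\<close> must climb all layers, because letter 1 leads to the next layer and letter 0
  stays in its layer. It enters the first layer at its first node, leaves the last layer from its
  first node, and the two powers of \<open>a\<close> force it to pass through copies of the same index. Hence the
  query has an answer iff the blocks contain \<open>i\<close>, \<open>k\<close>, \<open>j\<close> with \<open>A i k\<close>, \<open>B k j\<close> and \<open>\<not> C i j\<close>.
  There are \<open>O((n / s)\<^sup>3)\<close> calls with time \<open>O(s\<^sup>2 + s powr (3 - \<epsilon>))\<close>, and each of the exhaustive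
  searches, of time \<open>O(s\<^sup>3)\<close>, finds an entry of \<open>C\<close> not yet set, so there are at most \<open>n\<^sup>2\<close>
  of them. With \<open>s\<close> about \<open>n powr (1 / 4)\<close> the total is \<open>O(n powr (3 - min \<epsilon> 1 / 4))\<close>.
\<close>

section \<open>Timed reasoning about programs\<close>

text \<open>One call yields one bit, so the product cannot be read off from a single query. The
  route is the subcubic reduction of matrix multiplication to triangle detection: blocks of
  \<open>A\<close>, of \<open>B\<close> and of the complement of the current \<open>C\<close> form a
  tripartite graph, and a triangle in it exposes an entry of the product not yet found. The obstacle
  is that a regular path query cannot compare two nodes of a path with each other, as closing a
  triangle demands. The chains translate an index into a number of letters, and the query compares
  these numbers. Listing all exponents separately would make the query quadratic in
  \<open>s\<close>; nesting keeps its length linear, which matters because the length enters the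
  time bound with the same exponent as the number of nodes. The fourth root is a convenient choice:
  every block size n^g with 0 < g < 1/3 keeps the searches, of total cost about n^2 s^3, subcubic.
  The minimum of \<epsilon> and 1 appears because writing a database takes quadratic time, however
  fast the subroutine is.\<close>

lemma fits_mono: "fits W e s \<Longrightarrow> W \<le> W' \<Longrightarrow> fits W' e s"
  by (induction e) auto

text \<open>The hypothesis on the subroutine fixes a word bound from the length of its own short
  input, whereas \<open>Call\<close> executes it under the bound of the caller; this lemma bridges
  the two.\<close>

lemma exec_mono:
  assumes "exec W c s t s'" and "W \<le> W'"
  shows "exec W' c s t s'"
  using assms
proof (induction rule: exec.induct)
  case (Call a s l b k P t s')
  have "exec W' (Call P a l b k) s
      (1 + cost a + cost l + cost b + cost k + val l s + val k s + t)
      (fst s, \<lambda>i. if val b s \<le> i \<and> i < val b s + val k s then snd s' (i - val b s) else snd s i)"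
    using Call by (intro exec.Call) (auto intro: fits_mono)
  then show ?case .
qed (blast intro: exec.intros fits_mono)+

text \<open>
  The condition \<open>fits\<close> never has to be checked by hand: if all stored words are below \<open>M\<close>, then the
  value of an arithmetic expression \<open>e\<close> is below \<open>M ^ cost e\<close>, so a word bound polynomial in \<open>M\<close>
  of sufficiently large constant degree suffices.
\<close>

fun arithmetic :: "exp \<Rightarrow> bool" where
  "arithmetic (Num k) \<longleftrightarrow> k < 10"
| "arithmetic (Var x) \<longleftrightarrow> True"
| "arithmetic (Mem e) \<longleftrightarrow> arithmetic e"
| "arithmetic (Op f e1 e2) \<longleftrightarrow>
     f \<in> {Add, Sub, Mul, Div, Less, Equal} \<and> arithmetic e1 \<and> arithmetic e2"

definition small_words :: "nat \<Rightarrow> state \<Rightarrow> bool" where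
  "small_words M s \<longleftrightarrow> (\<forall>x. fst s x < M) \<and> (\<forall>a. snd s a < M)"

lemma small_words_mono: "small_words M st \<Longrightarrow> M \<le> M' \<Longrightarrow> small_words M' st"
  unfolding small_words_def by (blast intro: less_le_trans)

text \<open>The factor 2 is for addition and for the truth values of comparisons; subtraction and
  division never exceed \<open>x\<close>. Left shift is absent from the list, its values not being
  polynomially bounded.\<close>

lemma apply_bop_less:
  assumes "f \<in> {Add, Sub, Mul, Div, Less, Equal}"
    and "x < X" "y < Y" "X \<le> X * Y" "Y \<le> X * Y" "2 * (X * Y) \<le> R"
  shows "apply_bop f x y < R"
proof -
  obtain Z where Z: "X * Y = Z" by simp
  have "x * y \<le> Z" using assms unfolding Z[symmetric] by (intro mult_le_mono) auto
  moreover have "x div y < X" using assms(2) div_le_dividend le_less_trans by blast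
  ultimately show ?thesis using assms unfolding Z by auto
qed

text \<open>Each operation adds one to the cost, and the resulting extra factor \<open>M\<close>
  absorbs the factor 2 of \<open>apply_bop_less\<close>. Constants, being below 10, are covered by
  \<open>10 \<le> M\<close>.\<close>

lemma val_less_power_cost:
  assumes "arithmetic e" "small_words M s" "10 \<le> M"
  shows "val e s < M ^ cost e"
  using assms(1)
proof (induction e)
  case (Num k)
  then show ?case using assms(3) by simp
next
  case (Var x)
  then show ?case using assms(2) by (simp add: small_words_def)
next
  case (Mem e)
  have "snd s (val e s) < M" using assms(2) by (simp add: small_words_def)
  also have "M ^ 1 \<le> M ^ cost (Mem e)" using assms(3) by (intro power_increasing) auto
  finally show ?case by simp
next
  case (Op f e1 e2)
  let ?x = "val e1 s" and ?y = "val e2 s" and ?X = "M ^ cost e1" and ?Y = "M ^ cost e2"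
  have xy: "?x < ?X" "?y < ?Y" using Op by auto
  then have XY: "1 \<le> ?X" "1 \<le> ?Y" by auto
  have eq: "M ^ cost (Op f e1 e2) = M * (?X * ?Y)" by (simp add: power_add)
  show ?case unfolding val.simps eq
  proof (rule apply_bop_less)
    show "f \<in> {Add, Sub, Mul, Div, Less, Equal}" using Op.prems by simp
    show "?X \<le> ?X * ?Y" "?Y \<le> ?X * ?Y" using XY by simp_all
    show "2 * (?X * ?Y) \<le> M * (?X * ?Y)" using assms(3) by (intro mult_le_mono1) simp
  qed (fact xy)+
qed

lemma fits_power:
  assumes "arithmetic e" "small_words M s" "10 \<le> M" "M ^ cost e \<le> W"
  shows "fits W e s"
  using assms(1,4)
proof (induction e)
  case (Mem e)
  have "M ^ cost e \<le> M ^ cost (Mem e)" using assms(3) by (intro power_increasing) auto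
  then have "M ^ cost e \<le> W" using Mem.prems(2) by (rule le_trans)
  moreover have "snd s (val e s) < W"
    using less_le_trans[OF val_less_power_cost[OF Mem.prems(1) assms(2,3)] Mem.prems(2)] by simp
  ultimately show ?case using Mem by simp
next
  case (Op f e1 e2)
  have "M ^ cost e1 \<le> M ^ cost (Op f e1 e2)" "M ^ cost e2 \<le> M ^ cost (Op f e1 e2)"
    using assms(3) by (intro power_increasing; simp)+
  then show ?case
    using Op val_less_power_cost[of "Op f e1 e2" M s] assms(2,3) by auto
qed (use assms(2,3) in \<open>auto simp: small_words_def intro: less_le_trans\<close>)

text \<open>The programs contain finitely many expressions, all of cost well below 1000. A uniform
  cap lets one assumption, \<open>M ^ 1000 \<le> W\<close>, serve for all of them.\<close>

definition moderate :: "exp \<Rightarrow> bool" where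
  "moderate e \<longleftrightarrow> arithmetic e \<and> cost e \<le> 1000"

definition words :: "(nat \<Rightarrow> nat) \<Rightarrow> nat \<Rightarrow> nat list \<Rightarrow> bool" where
  "words m a xs \<longleftrightarrow> (\<forall>i < length xs. m (a + i) = xs ! i)"

text \<open>\<open>M\<close> bounds the words stored between commands, \<open>W\<close> the values
  that occur while one expression is evaluated. Only the former bound has to be maintained along a
  run.\<close>

locale bounded_words =
  fixes W M :: nat
  assumes ten_le_M: "10 \<le> M" and M_power: "M ^ 1000 \<le> W"
begin

lemma fits_moderate: "moderate e \<Longrightarrow> small_words M s \<Longrightarrow> fits W e s"
proof -
  assume e: "moderate e" and s: "small_words M s"
  have "M ^ cost e \<le> M ^ 1000"
    using e ten_le_M by (intro power_increasing) (auto simp: moderate_def)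
  then show "fits W e s"
    using fits_power[of e M s W] e s ten_le_M M_power le_trans unfolding moderate_def by blast
qed

lemma M_le_W: "M \<le> W"
proof -
  have "M ^ 1 \<le> M ^ 1000" using ten_le_M by (intro power_increasing) auto
  then show ?thesis using M_power by simp
qed

text \<open>
  \<open>\<Phi>\<close> is the potential of an amortised analysis: \<open>T\<close> bounds the time plus the increase of \<open>\<Phi>\<close>.
\<close>

definition run :: "(state \<Rightarrow> nat) \<Rightarrow> com \<Rightarrow> state \<Rightarrow> nat \<Rightarrow> (state \<Rightarrow> bool) \<Rightarrow> bool" where
  "run \<Phi> c s T Q \<longleftrightarrow> (small_words M s \<longrightarrow>
     (\<exists>t s'. exec W c s t s' \<and> small_words M s' \<and> t + \<Phi> s' \<le> T + \<Phi> s \<and> Q s'))"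

abbreviation "run\<^sub>0 \<equiv> run (\<lambda>_. 0)"

lemma run_mono:
  assumes "run \<Phi> c s T Q" "T \<le> T'" "\<And>s'. Q s' \<Longrightarrow> Q' s'"
  shows "run \<Phi> c s T' Q'"
  using assms unfolding run_def by (meson add_le_mono1 le_trans)

text \<open>Turns a plain time bound into an amortised one: whatever exceeds the budget
  \<open>T'\<close> must be covered by a drop of \<open>\<Phi>\<close>.\<close>

lemma run_potential:
  assumes "run\<^sub>0 c s T (\<lambda>s'. Q s' \<and> T + \<Phi> s' \<le> T' + \<Phi> s)"
  shows "run \<Phi> c s T' Q"
  using assms unfolding run_def by fastforce

lemma run_Skip: "Q s \<Longrightarrow> run\<^sub>0 Skip s 1 Q"
  unfolding run_def using exec.Skip[of W s] by (intro impI exI[of _ 1] exI[of _ s]) simp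

lemma run_Assign:
  assumes "moderate e" "val e s < M" "Q ((fst s)(x := val e s), snd s)"
  shows "run\<^sub>0 (x ::= e) s (1 + cost e) Q"
  unfolding run_def
  using exec.Assign[OF fits_moderate[OF assms(1)], of s x] assms(2,3)
  by (fastforce simp: small_words_def)

lemma run_Store:
  assumes "moderate a" "moderate e" "val e s < M" "Q (fst s, (snd s)(val a s := val e s))"
  shows "run\<^sub>0 (Store a e) s (1 + cost a + cost e) Q"
  unfolding run_def
  using exec.Store[OF fits_moderate[OF assms(1)] fits_moderate[OF assms(2)], of s] assms(3,4)
  by (fastforce simp: small_words_def)

lemma run_Seq:
  assumes "run \<Phi> c1 s T1 (\<lambda>s'. run \<Phi> c2 s' T2 Q)"
  shows "run \<Phi> (c1 ;; c2) s (T1 + T2) Q"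
  unfolding run_def
proof
  assume "small_words M s"
  then obtain t s' where 1: "exec W c1 s t s'" "small_words M s'" "t + \<Phi> s' \<le> T1 + \<Phi> s"
      "run \<Phi> c2 s' T2 Q"
    using assms unfolding run_def[of _ c1] by auto
  then obtain t' s'' where 2: "exec W c2 s' t' s''" "small_words M s''"
      "t' + \<Phi> s'' \<le> T2 + \<Phi> s'" "Q s''"
    unfolding run_def by auto
  have "exec W (c1 ;; c2) s (t + t') s''" using 1 2 by (auto intro: exec.Seq)
  moreover have "(t + t') + \<Phi> s'' \<le> T1 + T2 + \<Phi> s" using 1 2 by linarith
  ultimately show "\<exists>t s'. exec W (c1 ;; c2) s t s' \<and> small_words M s' \<and>
      t + \<Phi> s' \<le> T1 + T2 + \<Phi> s \<and> Q s'" using 2 by blast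
qed

lemma run_If:
  assumes "moderate e"
    and "val e s \<noteq> 0 \<Longrightarrow> run \<Phi> c1 s T Q" and "val e s = 0 \<Longrightarrow> run \<Phi> c2 s T Q"
  shows "run \<Phi> (If e c1 c2) s (1 + cost e + T) Q"
  unfolding run_def
proof
  assume s: "small_words M s"
  note e = fits_moderate[OF assms(1) s]
  have "\<exists>t s'. exec W (If e c1 c2) s (1 + cost e + t) s' \<and> small_words M s' \<and>
      t + \<Phi> s' \<le> T + \<Phi> s \<and> Q s'"
    using assms(2,3) s unfolding run_def
    by (cases "val e s = 0") (blast intro: exec.IfTrue[OF e] exec.IfFalse[OF e])+
  then obtain t s' where ts: "exec W (If e c1 c2) s (1 + cost e + t) s'" "small_words M s'"
      "t + \<Phi> s' \<le> T + \<Phi> s" "Q s'" by blast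
  then show "\<exists>t s'. exec W (If e c1 c2) s t s' \<and> small_words M s' \<and>
      t + \<Phi> s' \<le> 1 + cost e + T + \<Phi> s \<and> Q s'"
    by (intro exI[of _ "1 + cost e + t"] exI[of _ s']) simp
qed

text \<open>The variant \<open>f\<close> also bounds the number of iterations still to come, so
  termination and the budget follow from one induction. The body cost \<open>B\<close> is
  amortised.\<close>

lemma run_While:
  assumes e: "moderate e"
    and body: "\<And>s. Inv s \<Longrightarrow> val e s \<noteq> 0 \<Longrightarrow> run \<Phi> c s B (\<lambda>s'. Inv s' \<and> f s' < (f s :: nat))"
    and fin: "\<And>s. Inv s \<Longrightarrow> val e s = 0 \<Longrightarrow> Q s"
    and "Inv s"
  shows "run \<Phi> (While e c) s (f s * (1 + cost e + B) + (1 + cost e)) Q"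
  using \<open>Inv s\<close>
proof (induction "f s" arbitrary: s rule: less_induct)
  case less
  show ?case
    unfolding run_def
  proof
    assume s: "small_words M s"
    note fits = fits_moderate[OF e s]
    let ?X = "1 + cost e + B"
    show "\<exists>t s'. exec W (While e c) s t s' \<and> small_words M s' \<and>
      t + \<Phi> s' \<le> f s * ?X + (1 + cost e) + \<Phi> s \<and> Q s'"
    proof (cases "val e s = 0")
      case True
      then show ?thesis
        using exec.WhileFalse[OF fits True] s fin[OF less.prems] by fastforce
    next
      case False
      obtain t s' where 1: "exec W c s t s'" "small_words M s'" "t + \<Phi> s' \<le> B + \<Phi> s"
          "Inv s'" "f s' < f s"
        using body[OF less.prems False] s unfolding run_def by auto
      obtain t' s'' where 2: "exec W (While e c) s' t' s''" "small_words M s''"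
          "t' + \<Phi> s'' \<le> f s' * ?X + (1 + cost e) + \<Phi> s'" "Q s''"
        using less.hyps[OF 1(5,4)] 1(2) unfolding run_def by auto
      \<comment> \<open>The drop of the variant releases one share \<open>?X\<close>, which pays for
        the present iteration.\<close>
      have "Suc (f s') * ?X \<le> f s * ?X" using 1(5) by (intro mult_le_mono1) simp
      then have "1 + cost e + t + t' + \<Phi> s'' \<le> f s * ?X + (1 + cost e) + \<Phi> s"
        using 1(3) 2(3) by simp
      then show ?thesis
        using exec.WhileTrue[OF fits False 1(1) 2(1)] 2(2,4) by blast
    qed
  qed
qed

text \<open>The limit \<open>e\<close> is re-evaluated before every iteration, so the invariant must
  fix its value. \<open>\<Phi>\<close> ignores registers so that counter updates leave it alone. The
  cap 900 leaves room for the comparison with the counter within \<open>moderate\<close>.\<close>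

lemma run_For:
  assumes e: "moderate e" "cost e \<le> 900"
    and \<Phi>: "\<And>r m k. \<Phi> (r(x := k), m) = \<Phi> (r, m)"
    and N: "N < M"
    and init: "Inv 0 ((fst s)(x := 0), snd s)"
    and bound: "\<And>i s. Inv i s \<Longrightarrow> i \<le> N \<Longrightarrow> fst s x = i \<Longrightarrow> val e s = N"
    and body: "\<And>i s. Inv i s \<Longrightarrow> i < N \<Longrightarrow> fst s x = i \<Longrightarrow>
       run \<Phi> c s B (\<lambda>s'. fst s' x = i \<and> Inv (Suc i) ((fst s')(x := Suc i), snd s'))"
    and fin: "\<And>s. Inv N s \<Longrightarrow> fst s x = N \<Longrightarrow> Q s"
  shows "run \<Phi> (For x e c) s (N * (B + cost e + 7) + cost e + 5) Q"
proof -
  define J where "J s \<longleftrightarrow> fst s x \<le> N \<and> Inv (fst s x) s" for s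
  have lift: "run \<Phi> (x ::= a) s (1 + cost a) R"
    if "moderate a" "val a s < M" "R ((fst s)(x := val a s), snd s)" for a s R
    by (rule run_potential, rule run_Assign) (use that \<Phi>[of "fst s"] in \<open>auto\<close>)
  have cond: "moderate (Var x \<^bold>< e)" "moderate (Var x \<^bold>+ Num 1)" "moderate (Num 0)"
    using e by (auto simp: moderate_def)
  have while: "run \<Phi> (While (Var x \<^bold>< e) (c ;; x ::= Var x \<^bold>+ Num 1)) s
      ((N - fst s x) * (1 + cost (Var x \<^bold>< e) + (B + 4)) + (1 + cost (Var x \<^bold>< e))) Q"
    if "J s" for s
  proof (rule run_While[where Inv = J and f = "\<lambda>s. N - fst s x"])
    fix s assume J: "J s" and v: "val (Var x \<^bold>< e) s \<noteq> 0"
    then have "val e s = N" using bound J_def by blast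
    then have less: "fst s x < N" using v by (simp split: if_splits)
    show "run \<Phi> (c ;; x ::= Var x \<^bold>+ Num 1) s (B + 4) (\<lambda>s'. J s' \<and> N - fst s' x < N - fst s x)"
    proof (rule run_Seq, rule run_mono)
      show "run \<Phi> c s B (\<lambda>s'. fst s' x = fst s x \<and>
          Inv (Suc (fst s x)) ((fst s')(x := Suc (fst s x)), snd s'))"
        using body[of "fst s x" s] J less J_def by simp
    next
      fix s' assume s': "fst s' x = fst s x \<and> Inv (Suc (fst s x)) ((fst s')(x := Suc (fst s x)), snd s')"
      have "run \<Phi> (x ::= Var x \<^bold>+ Num 1) s' (1 + cost (Var x \<^bold>+ Num 1))
          (\<lambda>s'. J s' \<and> N - fst s' x < N - fst s x)"
        by (rule lift) (use s' less N cond in \<open>auto simp: J_def\<close>)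
      then show "run \<Phi> (x ::= Var x \<^bold>+ Num 1) s' 4 (\<lambda>s'. J s' \<and> N - fst s' x < N - fst s x)"
        by (rule run_mono) simp_all
    qed simp
  next
    fix s assume J: "J s" and v: "val (Var x \<^bold>< e) s = 0"
    then have "val e s = N" using bound J_def by blast
    then have "fst s x = N" using v J by (auto simp: J_def split: if_splits)
    then show "Q s" using J fin[of s] by (simp add: J_def)
  qed (use cond that in auto)
  have "J ((fst s)(x := 0), snd s)" using init by (simp add: J_def)
  from while[OF this] have "run \<Phi> (For x e c) s
      (2 + (N * (1 + cost (Var x \<^bold>< e) + (B + 4)) + (1 + cost (Var x \<^bold>< e)))) Q"
    unfolding For_def using N
    by (intro run_Seq, intro run_mono[OF lift[OF cond(3)]]) auto
  then show ?thesis by (rule run_mono) (auto simp: algebra_simps)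
qed

text \<open>The private store of the callee is exactly \<open>initial_state xs\<close>, so a
  guarantee about a stand-alone run applies as it is. A single word is copied back, the yes/no
  answer.\<close>

lemma run_Call:
  assumes "moderate a" "moderate l" "moderate b" "moderate k"
    and "val l s = length xs" "words (snd s) (val a s) xs" "val k s = 1"
    and "val a s + length xs \<le> W" "val b s < W"
    and "exec W P (initial_state xs) t s'" "t \<le> T" "snd s' 0 < M"
    and "Q (fst s, (snd s)(val b s := snd s' 0))"
  shows "run\<^sub>0 (Call P a l b k) s (1 + cost a + cost l + cost b + cost k + length xs + 1 + T) Q"
  unfolding run_def
proof
  assume s: "small_words M s"
  have init: "(\<lambda>_. 0, \<lambda>i. if i < val l s then snd s (val a s + i) else 0) = initial_state xs"
    using assms(5,6) by (auto simp: initial_state_def words_def)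
  have out: "(\<lambda>i. if val b s \<le> i \<and> i < val b s + val k s then snd s' (i - val b s) else snd s i)
      = (snd s)(val b s := snd s' 0)"
    using assms(7) by auto
  have "exec W (Call P a l b k) s
      (1 + cost a + cost l + cost b + cost k + val l s + val k s + t)
      (fst s, (snd s)(val b s := snd s' 0))"
    unfolding out[symmetric]
    by (intro exec.Call fits_moderate s) (use assms init in auto)
  then show "\<exists>t s''. exec W (Call P a l b k) s t s'' \<and> small_words M s'' \<and>
      t + 0 \<le> 1 + cost a + cost l + cost b + cost k + length xs + 1 + T + 0 \<and> Q s''"
    by (intro exI conjI, assumption) (use s assms in \<open>auto simp: small_words_def\<close>)
qed

end

section \<open>The gadget\<close>

lemma labelled_path_Nil: "labelled_path D u [] v \<longleftrightarrow> u = v \<and> u \<in> nodes D"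
  by (auto elim: labelled_path.cases intro: labelled_path.intros)

lemma labelled_path_Cons:
  "labelled_path D u (a # w) v \<longleftrightarrow> (\<exists>x. (u, a, x) \<in> arcs D \<and> labelled_path D x w v)"
  by (auto elim: labelled_path.cases intro: labelled_path.intros)

lemma labelled_path_nodes:
  assumes "graph_db_over \<Sigma> D" "labelled_path D u w v"
  shows "u \<in> nodes D"
  using assms(2,1) by cases (auto simp: graph_db_over_def)

lemma labelled_path_append:
  assumes "graph_db_over \<Sigma> D"
  shows "labelled_path D u (w @ w') v \<longleftrightarrow> (\<exists>x. labelled_path D u w x \<and> labelled_path D x w' v)"
  using labelled_path_nodes[OF assms]
  by (induction w arbitrary: u) (auto simp: labelled_path_Nil labelled_path_Cons)

section \<open>A database that detects triangles in tripartite graphs\<close>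

definition chain_arc :: "nat \<Rightarrow> nat \<Rightarrow> nat \<Rightarrow> bool" where
  "chain_arc s u v \<longleftrightarrow> u + 1 = v \<and> v < s \<or> v + 1 = u \<and> 3 * s \<le> v \<and> u < 4 * s"

definition layer_arc ::
  "nat \<Rightarrow> (nat \<Rightarrow> nat \<Rightarrow> bool) \<Rightarrow> (nat \<Rightarrow> nat \<Rightarrow> bool) \<Rightarrow> (nat \<Rightarrow> nat \<Rightarrow> bool) \<Rightarrow> nat \<Rightarrow> nat \<Rightarrow> bool"
where
  "layer_arc s P Q R u v \<longleftrightarrow>
     u < s \<and> s \<le> v \<and> v < 2 * s \<and> P u (v - s) \<or>
     s \<le> u \<and> u < 2 * s \<and> 2 * s \<le> v \<and> v < 3 * s \<and> Q (u - s) (v - 2 * s) \<or>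
     2 * s \<le> u \<and> u < 3 * s \<and> 3 * s \<le> v \<and> v < 4 * s \<and> R (u - 2 * s) (v - 3 * s) \<or>
     u = 4 * s \<and> v = 0 \<or>
     u = 3 * s \<and> v = 4 * s + 1"

text \<open>The relations are arbitrary here, without reference to matrices: \<open>P x y\<close>,
  \<open>Q y z\<close>, \<open>R z x\<close> form a triangle between three parts of size
  \<open>s\<close>, and the fourth layer is a second copy of the first part.\<close>

definition gadget ::
  "nat \<Rightarrow> (nat \<Rightarrow> nat \<Rightarrow> bool) \<Rightarrow> (nat \<Rightarrow> nat \<Rightarrow> bool) \<Rightarrow> (nat \<Rightarrow> nat \<Rightarrow> bool) \<Rightarrow> (nat, nat) graph_db"
where
  "gadget s P Q R = ({..<4 * s + 2},
     {(u, a, v). u < 4 * s + 2 \<and> v < 4 * s + 2 \<and>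
        (a = 0 \<and> chain_arc s u v \<or> a = 1 \<and> layer_arc s P Q R u v)})"

lemma nodes_gadget: "nodes (gadget s P Q R) = {..<4 * s + 2}"
  by (simp add: gadget_def nodes_def)

lemma arcs_gadget:
  "(u, a, v) \<in> arcs (gadget s P Q R) \<longleftrightarrow> u < 4 * s + 2 \<and> v < 4 * s + 2 \<and>
     (a = 0 \<and> chain_arc s u v \<or> a = 1 \<and> layer_arc s P Q R u v)"
  by (simp add: gadget_def arcs_def)

lemma db_instance_gadget: "2 \<le> \<sigma> \<Longrightarrow> db_instance \<sigma> (gadget s P Q R)"
  by (auto simp: db_instance_def graph_db_over_def nodes_gadget) (auto simp: arcs_gadget)

lemma graph_db_over_gadget: "graph_db_over {..<2} (gadget s P Q R)"
  using db_instance_gadget[of 2] by (simp add: db_instance_def)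

text \<open>A height function, following the order in which a path climbs rather than the numbering
  of the nodes.\<close>

definition gadget_layer :: "nat \<Rightarrow> nat \<Rightarrow> nat" where
  "gadget_layer s u = (if u = 4 * s then 0 else if u < s then 1 else if u < 2 * s then 2
     else if u < 3 * s then 3 else if u < 4 * s then 4 else 5)"

text \<open>Used to pin down the start of a path: heights range from 0 to 5 only, so a word with
  five letters 1 must lead from the bottom to the top.\<close>

lemma gadget_layer_path:
  assumes "labelled_path (gadget s P Q R) u w v" "1 \<le> s"
  shows "gadget_layer s v = gadget_layer s u + count_list w 1"
  using assms
proof (induction rule: labelled_path.induct)
  case (step u a w as v)
  have "gadget_layer s w = gadget_layer s u + of_bool (a = 1)"
    using step.hyps(1) \<open>1 \<le> s\<close>
    unfolding arcs_gadget gadget_layer_def chain_arc_def layer_arc_def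
    by (elim conjE disjE) auto
  then show ?case using step by auto
qed simp

lemma ascending_chain_path:
  assumes "u < s"
  shows "labelled_path (gadget s P Q R) u (replicate k 0) v \<longleftrightarrow> v = u + k \<and> v < s"
  using assms
proof (induction k arbitrary: u)
  case 0
  then show ?case by (auto simp: labelled_path_Nil nodes_gadget)
next
  case (Suc k)
  have *: "(u, 0, x) \<in> arcs (gadget s P Q R) \<longleftrightarrow> x = Suc u \<and> x < s" for x
    using Suc.prems by (auto simp: arcs_gadget chain_arc_def)
  have "labelled_path (gadget s P Q R) u (replicate (Suc k) 0) v \<longleftrightarrow>
      Suc u < s \<and> labelled_path (gadget s P Q R) (Suc u) (replicate k 0) v"
    unfolding replicate_Suc labelled_path_Cons * by blast
  then show ?case using Suc.IH[of "Suc u"] by auto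
qed

lemma descending_chain_path:
  assumes "3 * s \<le> u" "u < 4 * s"
  shows "labelled_path (gadget s P Q R) u (replicate k 0) v \<longleftrightarrow> u = v + k \<and> 3 * s \<le> v"
  using assms
proof (induction k arbitrary: u)
  case 0
  then show ?case by (auto simp: labelled_path_Nil nodes_gadget)
next
  case (Suc k)
  have *: "(u, 0, x) \<in> arcs (gadget s P Q R) \<longleftrightarrow> Suc x = u \<and> 3 * s \<le> x" for x
    using Suc.prems by (auto simp: arcs_gadget chain_arc_def)
  show ?case
  proof (cases "3 * s < u")
    case True
    then obtain x where x: "u = Suc x" "3 * s \<le> x" by (cases u) auto
    have "labelled_path (gadget s P Q R) u (replicate (Suc k) 0) v \<longleftrightarrow>
        labelled_path (gadget s P Q R) x (replicate k 0) v"
      unfolding replicate_Suc labelled_path_Cons * using x by auto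
    then show ?thesis using Suc.IH[of x] Suc.prems x by auto
  next
    \<comment> \<open>Now \<open>u = 3 * s\<close>, the end of the reverse chain, which no arc with
      letter 0 leaves.\<close>
    case False
    then show ?thesis
      unfolding replicate_Suc labelled_path_Cons * using Suc.prems by auto
  qed
qed

section \<open>The query, its language and its prefix form\<close>

fun nested_query :: "nat \<Rightarrow> nat rpq" where
  "nested_query 0 = Concat (Letter 1) (Concat (Letter 1) (Letter 1))"
| "nested_query (Suc m) =
     Alt (Concat (Letter 1) (Concat (Letter 1) (Letter 1)))
       (Concat (Letter 0) (Concat (nested_query m) (Letter 0)))"

definition gadget_query :: "nat \<Rightarrow> nat rpq" where
  "gadget_query m = Concat (Letter 1) (Concat (nested_query m) (Letter 1))"

lemma lang_nested_query:
  "lang (nested_query m) = {replicate k 0 @ [1, 1, 1] @ replicate k 0 | k. k \<le> m}"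
proof (induction m)
  case (Suc m)
  have "lang (nested_query (Suc m)) =
      insert [1, 1, 1] {0 # (replicate k 0 @ [1, 1, 1] @ replicate k 0) @ [0] | k. k \<le> m}"
    by (auto simp: Suc)
  also have "\<dots> = {replicate k 0 @ [1, 1, 1] @ replicate k 0 | k. k \<le> Suc m}" (is "?L = ?R")
  proof -
    \<comment> \<open>One more level of nesting puts a letter 0 on either side, turning exponent
      \<open>k\<close> into \<open>Suc k\<close>.\<close>
    have *: "0 # (replicate k 0 @ [1, 1, 1] @ replicate k 0) @ [0] =
        replicate (Suc k) 0 @ [1, 1, 1] @ replicate (Suc k) (0::nat)" for k
      by (simp add: replicate_append_same)
    have "(\<exists>k \<le> Suc m. P k) \<longleftrightarrow> P 0 \<or> (\<exists>k \<le> m. P (Suc k))" for P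
      by (metis Suc_le_mono le0 not0_implies_Suc)
    note split = this[of "\<lambda>k. w = replicate k 0 @ [1, 1, 1] @ replicate k 0" for w]
    have "w \<in> ?R \<longleftrightarrow> (\<exists>k\<le>Suc m. w = replicate k 0 @ [1, 1, 1] @ replicate k 0)" for w
      by blast
    then have "w \<in> ?R \<longleftrightarrow> w = [1, 1, 1] \<or>
        (\<exists>k\<le>m. w = replicate (Suc k) 0 @ [1, 1, 1] @ replicate (Suc k) 0)" for w
      unfolding split by simp
    then show ?thesis unfolding * by blast
  qed
  finally show ?case .
qed auto

lemma lang_gadget_query:
  "lang (gadget_query m) = {1 # replicate k 0 @ [1, 1, 1] @ replicate k 0 @ [1] | k. k \<le> m}"
  by (auto simp: gadget_query_def lang_nested_query)

lemma rpq_over_gadget_query: "2 \<le> \<sigma> \<Longrightarrow> rpq_over {..<\<sigma>} (gadget_query m)"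
proof -
  assume "2 \<le> \<sigma>"
  then have "set_rpq (nested_query m) \<subseteq> {..<\<sigma>}" by (induction m) auto
  then show ?thesis using \<open>2 \<le> \<sigma>\<close> by (auto simp: rpq_over_def gadget_query_def)
qed

lemma length_rpq_words: "length (rpq_words q) = rpq_length q"
  by (induction q) auto

lemma rpq_length_gadget_query: "rpq_length (gadget_query m) = 10 * m + 9"
proof -
  have "rpq_length (nested_query m) = 10 * m + 5" by (induction m) auto
  then show ?thesis by (simp add: gadget_query_def)
qed

text \<open>The nine repeated words are one level up to its nested subquery: \<open>Alt\<close>,
  then \<open>bbb\<close>, then \<open>Concat a (Concat\<close>, where 5 and 4 encode the letters 1
  and 0. Only the closing letter follows the subquery, so a program can emit the query with two
  plain loops and no recursion.\<close>

lemma rpq_words_nested_query: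
  "rpq_words (nested_query m) =
     concat (replicate m [2, 1, 5, 1, 5, 5, 1, 4, 1]) @ [1, 5, 1, 5, 5] @ replicate m 4"
  by (induction m) (auto simp: replicate_append_same)

lemma gadget_path:
  assumes "1 \<le> s"
  shows "labelled_path (gadget s P Q R) u (1 # replicate k 0 @ [1, 1, 1] @ replicate k 0 @ [1]) v \<longleftrightarrow>
    u = 4 * s \<and> v = 4 * s + 1 \<and> k < s \<and> (\<exists>y<s. \<exists>z<s. P k y \<and> Q y z \<and> R z k)"
    (is "?path \<longleftrightarrow> ?rhs")
proof
  let ?G = "gadget s P Q R"
  note append = labelled_path_append[OF graph_db_over_gadget]
  have count: "count_list (replicate k 0 @ w) (1::nat) = count_list w 1" for w
    by (induction k) auto
  { assume path: ?path
    \<comment> \<open>The word has five letters 1, three in the middle and one at each end.\<close>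
    have "gadget_layer s v = gadget_layer s u + 5"
      using gadget_layer_path[OF path assms] by (simp add: count)
    then have u: "u = 4 * s" by (auto simp: gadget_layer_def split: if_splits)
    obtain x0 x1 x2 x3 x4 x5 where arcs:
        "(u, 1, x0) \<in> arcs ?G" "labelled_path ?G x0 (replicate k 0) x1"
        "(x1, 1, x2) \<in> arcs ?G" "(x2, 1, x3) \<in> arcs ?G" "(x3, 1, x4) \<in> arcs ?G"
        "labelled_path ?G x4 (replicate k 0) x5" "(x5, 1, v) \<in> arcs ?G"
      using path by (auto simp: labelled_path_Cons labelled_path_Nil append)
    have "x0 = 0" using arcs(1) assms u by (auto simp: arcs_gadget layer_arc_def)
    then have x1: "x1 = k" "k < s" using arcs(2) ascending_chain_path[of 0 s] assms by auto
    have x2: "s \<le> x2" "x2 < 2 * s" "P k (x2 - s)"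
      using arcs(3) x1 assms by (auto simp: arcs_gadget layer_arc_def)
    have x3: "2 * s \<le> x3" "x3 < 3 * s" "Q (x2 - s) (x3 - 2 * s)"
      using arcs(4) x2 assms by (auto simp: arcs_gadget layer_arc_def)
    have x4: "3 * s \<le> x4" "x4 < 4 * s" "R (x3 - 2 * s) (x4 - 3 * s)"
      using arcs(5) x3 assms by (auto simp: arcs_gadget layer_arc_def)
    have x5: "x4 = x5 + k" "3 * s \<le> x5"
      using arcs(6) descending_chain_path[OF x4(1,2)] by auto
    \<comment> \<open>In the last layer only node \<open>3 * s\<close> has an outgoing arc with
      letter 1. So the descent by \<open>k\<close> steps began at \<open>3 * s + k\<close>, the copy
      of the very index \<open>k\<close> at which the first layer was left.\<close>
    have v: "x5 = 3 * s" "v = 4 * s + 1"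
      using arcs(7) x4 x5 assms by (auto simp: arcs_gadget layer_arc_def)
    show ?rhs
      using u v x1 x2 x3 x4 x5 by (intro conjI exI[of _ "x2 - s"] exI[of _ "x3 - 2 * s"]) auto
  }
  assume ?rhs
  then obtain y z where yz: "u = 4 * s" "v = 4 * s + 1" "k < s" "y < s" "z < s"
      "P k y" "Q y z" "R z k" by blast
  have "(u, 1, 0) \<in> arcs ?G" using yz by (auto simp: arcs_gadget layer_arc_def)
  moreover have "labelled_path ?G 0 (replicate k 0) k"
    using yz ascending_chain_path[of 0 s] by auto
  moreover have "(k, 1, s + y) \<in> arcs ?G" using yz by (auto simp: arcs_gadget layer_arc_def)
  moreover have "(s + y, 1, 2 * s + z) \<in> arcs ?G" using yz by (auto simp: arcs_gadget layer_arc_def)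
  moreover have "(2 * s + z, 1, 3 * s + k) \<in> arcs ?G" using yz by (auto simp: arcs_gadget layer_arc_def)
  moreover have "labelled_path ?G (3 * s + k) (replicate k 0) (3 * s)"
    using yz descending_chain_path[of s "3 * s + k"] by auto
  moreover have "(3 * s, 1, v) \<in> arcs ?G" using yz by (auto simp: arcs_gadget layer_arc_def)
  moreover have "v \<in> nodes ?G" using yz by (simp add: nodes_gadget)
  ultimately show ?path
    unfolding append labelled_path_Cons labelled_path_Nil append_Cons append_Nil by blast
qed

text \<open>Only one fixed pair can be an answer, so on gadgets Check (for this pair), Boole and
  Witness amount to the same question.\<close>

lemma answers_gadget:
  assumes "1 \<le> s"
  shows "answers (gadget_query s) (gadget s P Q R) =
    (if \<exists>x<s. \<exists>y<s. \<exists>z<s. P x y \<and> Q y z \<and> R z x then {(4 * s, 4 * s + 1)} else {})"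
proof -
  have "(u, v) \<in> answers (gadget_query s) (gadget s P Q R) \<longleftrightarrow>
      (\<exists>k\<le>s. u = 4 * s \<and> v = 4 * s + 1 \<and> k < s \<and> (\<exists>y<s. \<exists>z<s. P k y \<and> Q y z \<and> R z k))" for u v
    unfolding answers_def lang_gadget_query using gadget_path[OF assms, of P Q R] by blast
  \<comment> \<open>The language also contains the exponent \<open>s\<close>, which no path
    realises; the bound from the language is absorbed by \<open>k < s\<close>.\<close>
  moreover have "k \<le> s" if "k < s" for k using that by simp
  ultimately have "(u, v) \<in> answers (gadget_query s) (gadget s P Q R) \<longleftrightarrow>
      u = 4 * s \<and> v = 4 * s + 1 \<and> (\<exists>x<s. \<exists>y<s. \<exists>z<s. P x y \<and> Q y z \<and> R z x)" for u v
    by blast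
  then show ?thesis by (simp add: set_eq_iff)
qed

section \<open>The adjacency lists of the gadget\<close>

definition arc_entries ::
  "nat \<Rightarrow> (nat \<Rightarrow> nat \<Rightarrow> bool) \<Rightarrow> (nat \<Rightarrow> nat \<Rightarrow> bool) \<Rightarrow> (nat \<Rightarrow> nat \<Rightarrow> bool) \<Rightarrow> nat \<Rightarrow> nat \<Rightarrow> (nat \<times> nat) list"
where
  "arc_entries s P Q R u v =
     (if chain_arc s u v then [(0, v)] else []) @ (if layer_arc s P Q R u v then [(1, v)] else [])"

text \<open>Any order within a list is a legal encoding. This one scans the targets in increasing
  order, letter 0 before letter 1, as \<open>write_db\<close> does.\<close>

definition gadget_adjacency ::
  "nat \<Rightarrow> (nat \<Rightarrow> nat \<Rightarrow> bool) \<Rightarrow> (nat \<Rightarrow> nat \<Rightarrow> bool) \<Rightarrow> (nat \<Rightarrow> nat \<Rightarrow> bool) \<Rightarrow> (nat \<times> nat) list list"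
where
  "gadget_adjacency s P Q R =
     map (\<lambda>u. concat (map (arc_entries s P Q R u) [0..<4 * s + 2])) [0..<4 * s + 2]"

lemma length_gadget_adjacency: "length (gadget_adjacency s P Q R) = 4 * s + 2"
  by (simp add: gadget_adjacency_def)

lemma nth_gadget_adjacency:
  "u < 4 * s + 2 \<Longrightarrow>
   gadget_adjacency s P Q R ! u = concat (map (arc_entries s P Q R u) [0..<4 * s + 2])"
  by (simp add: gadget_adjacency_def del: upt_Suc)

lemma distinct_concat_arc_entries: "distinct (concat (map (arc_entries s P Q R u) [0..<k]))"
  by (induction k) (auto simp: arc_entries_def)

lemma encodes_db_gadget:
  "encodes_db (gadget s P Q R) (adjacency_words (gadget_adjacency s P Q R))"
  unfolding encodes_db_def
proof (intro exI conjI allI impI)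
  fix u assume u: "u < length (gadget_adjacency s P Q R)"
  then have nth: "gadget_adjacency s P Q R ! u = concat (map (arc_entries s P Q R u) [0..<4 * s + 2])"
    by (simp add: length_gadget_adjacency nth_gadget_adjacency del: upt_Suc)
  have entries: "(a, v) \<in> set (arc_entries s P Q R u x) \<longleftrightarrow>
      x = v \<and> (a = 0 \<and> chain_arc s u v \<or> a = 1 \<and> layer_arc s P Q R u v)" for a v x
    by (auto simp: arc_entries_def)
  show "distinct (gadget_adjacency s P Q R ! u)"
    unfolding nth by (rule distinct_concat_arc_entries)
  show "set (gadget_adjacency s P Q R ! u) = {(a, v). (u, a, v) \<in> arcs (gadget s P Q R)}"
    using u unfolding nth
    by (auto simp: entries arcs_gadget length_gadget_adjacency simp del: upt_Suc)
qed (simp_all add: nodes_gadget length_gadget_adjacency)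

lemma length_concat_le:
  assumes "\<And>x. x \<in> set xs \<Longrightarrow> length (f x) \<le> k"
  shows "length (concat (map f xs)) \<le> length xs * k"
  using assms by (induction xs) (auto intro: add_mono)

lemma length_concat_arc_entries:
  "length (concat (map (arc_entries s P Q R u) [0..<k])) \<le> 2 * k"
  using length_concat_le[of "[0..<k]" "arc_entries s P Q R u" 2] by (simp add: arc_entries_def mult.commute)

lemma length_concat_gadget_adjacency:
  assumes "k \<le> 4 * s + 2"
  shows "length (concat (take k (gadget_adjacency s P Q R))) \<le> k * (2 * (4 * s + 2))"
proof -
  have "take k (gadget_adjacency s P Q R) =
      map (\<lambda>u. concat (map (arc_entries s P Q R u) [0..<4 * s + 2])) [0..<k]"
    using assms by (simp add: gadget_adjacency_def take_map del: upt_Suc)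
  then show ?thesis
    using length_concat_le[of "[0..<k]" "\<lambda>u. concat (map (arc_entries s P Q R u) [0..<4 * s + 2])"
        "2 * (4 * s + 2)"]
      length_concat_arc_entries[of s P Q R _ "4 * s + 2"] by (simp del: upt_Suc)
qed

section \<open>Writing the input of the subroutine\<close>

lemma words_Nil: "words m a []"
  by (simp add: words_def)

lemma words_Cons: "words m a (x # xs) \<longleftrightarrow> m a = x \<and> words m (Suc a) xs"
  unfolding words_def by (auto simp: All_less_Suc2)

lemma words_append: "words m a (xs @ ys) \<longleftrightarrow> words m a xs \<and> words m (a + length xs) ys"
  by (induction xs arbitrary: a) (auto simp: words_Nil words_Cons)

lemma words_cong:
  assumes "words m a xs" "\<And>b. a \<le> b \<Longrightarrow> b < a + length xs \<Longrightarrow> m' b = m b"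
  shows "words m' a xs"
  using assms by (simp add: words_def)

lemma words_update: "a + length xs \<le> b \<Longrightarrow> words (m(b := y)) a xs \<longleftrightarrow> words m a xs"
  by (simp add: words_def)

lemma words_update_below: "b < a \<Longrightarrow> words (m(b := y)) a xs \<longleftrightarrow> words m a xs"
  by (simp add: words_def)

lemma run_emit:
  assumes "bounded_words W M"
    and "moderate e" "val e s < M" "fst s ''p'' + 1 < M"
    and "Q ((fst s)(''p'' := fst s ''p'' + 1), (snd s)(fst s ''p'' := val e s))"
  shows "bounded_words.run W M (\<lambda>_. 0) (emit e) s (6 + cost e) Q"
proof -
  interpret bounded_words W M by fact
  have "run\<^sub>0 (emit e) s ((1 + cost vp + cost e) + (1 + cost (vp \<^bold>+ Num 1))) Q"
    unfolding emit_def
    by (intro run_Seq run_Store run_Assign) (use assms in \<open>simp_all add: moderate_def\<close>)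
  then show ?thesis by (rule run_mono) simp_all
qed

definition flatten :: "(nat \<times> nat) list \<Rightarrow> nat list" where
  "flatten L = concat (map (\<lambda>(a, v). [a, v]) L)"

lemma flatten_simps:
  "flatten [] = []" "flatten (L @ L') = flatten L @ flatten L'" "flatten [(a, v)] = [a, v]"
  by (simp_all add: flatten_def)

lemma length_flatten: "length (flatten L) = 2 * length L"
  by (induction L) (auto simp: flatten_def)

text \<open>The last block may reach beyond \<open>n\<close>. Indices there are cut off, for the
  negated \<open>C\<close> as well, so they take part in no triangle.\<close>

definition in_blocks :: "nat \<Rightarrow> nat \<Rightarrow> nat \<Rightarrow> nat \<Rightarrow> (nat \<Rightarrow> nat \<Rightarrow> bool) \<Rightarrow> nat \<Rightarrow> nat \<Rightarrow> bool" where
  "in_blocks n s X Y F x y \<longleftrightarrow> X * s + x < n \<and> Y * s + y < n \<and> F (X * s + x) (Y * s + y)"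

definition matrices ::
  "nat \<Rightarrow> (nat \<Rightarrow> nat \<Rightarrow> bool) \<Rightarrow> (nat \<Rightarrow> nat \<Rightarrow> bool) \<Rightarrow> (nat \<Rightarrow> nat \<Rightarrow> bool) \<Rightarrow> (nat \<Rightarrow> nat) \<Rightarrow> bool"
where
  "matrices n A B C m \<longleftrightarrow> (\<forall>i<n. \<forall>j<n.
     m (1 + i * n + j) = of_bool (A i j) \<and>
     m (1 + n * n + i * n + j) = of_bool (B i j) \<and>
     m (1 + 2 * n * n + i * n + j) = of_bool (C i j))"

lemma row_major_less: "i < n \<Longrightarrow> j < n \<Longrightarrow> i * n + j < n * (n::nat)"
proof -
  assume "i < n" "j < n"
  then have "i * n + j < Suc i * n" by simp
  also have "\<dots> \<le> n * n" using \<open>i < n\<close> by (intro mult_le_mono1) simp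
  finally show ?thesis .
qed

lemma matrices_cong:
  assumes "matrices n A B C m" "\<And>a. a < 1 + 3 * n * n \<Longrightarrow> m' a = m a"
  shows "matrices n A B C m'"
  using assms(1) unfolding matrices_def
proof (intro allI impI)
  fix i j assume ij: "i < n" "j < n"
  note row_major_less[OF this]
  then show "m' (1 + i * n + j) = of_bool (A i j) \<and> m' (1 + n * n + i * n + j) = of_bool (B i j) \<and>
      m' (1 + 2 * n * n + i * n + j) = of_bool (C i j)"
    using assms(1) ij by (simp add: assms(2) matrices_def)
qed

text \<open>The pointer \<open>p\<close> and the counters are stored words too, so \<open>M\<close>
  must exceed the addresses they hold: about \<open>3 * n * n\<close> cells for the matrices and a
  few hundred times \<open>s * s\<close> for the input of the subroutine. Hence \<open>M\<close> is
  quadratic in \<open>n\<close>.\<close>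

locale search_setting = bounded_words +
  fixes n s d :: nat and A B :: "nat \<Rightarrow> nat \<Rightarrow> bool"
  assumes s: "1 \<le> s" "s \<le> n" and d: "d = 1 + 3 * n * n" and M: "1000 * (n * n) \<le> M"
begin

lemma size_bounds: "s \<le> s * s" "s * s \<le> n * n" "n \<le> n * n" "1 \<le> n" "d + 500 * (s * s) < M"
proof -
  show ss: "s \<le> s * s" "s * s \<le> n * n" "n \<le> n * n" "1 \<le> n"
    using s by (auto intro: mult_le_mono)
  have "1 \<le> n * n" using ss by linarith
  moreover have "d = 1 + 3 * (n * n)" by (simp add: d)
  ultimately show "d + 500 * (s * s) < M" using ss(2) M by linarith
qed

text \<open>\<open>\<rho>\<close> lists the counters of the enclosing loops, innermost first, with
  their current values. \<open>A\<close> and \<open>B\<close> are fixed by the locale; only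
  \<open>C\<close> changes.\<close>

definition layout :: "(string \<times> nat) list \<Rightarrow> (nat \<Rightarrow> nat \<Rightarrow> bool) \<Rightarrow> state \<Rightarrow> bool" where
  "layout \<rho> C st \<longleftrightarrow> fst st ''n'' = n \<and> fst st ''s'' = s \<and> fst st ''d'' = d \<and>
     (\<forall>(x, k) \<in> set \<rho>. fst st x = k) \<and> matrices n A B C (snd st)"

abbreviation "block_layout I K J \<equiv> layout [(''J'', J), (''K'', K), (''I'', I)]"

abbreviation "block_adjacency I K J C \<equiv>
  gadget_adjacency s (in_blocks n s I K A) (in_blocks n s K J B) (in_blocks n s J I (\<lambda>j i. \<not> C i j))"

abbreviation "block_entries I K J C \<equiv>
  arc_entries s (in_blocks n s I K A) (in_blocks n s K J B) (in_blocks n s J I (\<lambda>j i. \<not> C i j))"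

text \<open>What survives the preparation and the call of the subroutine: the block counters and all
  cells below \<open>d\<close>, hence the matrices. The registers used for writing are left
  open.\<close>

definition frame :: "state \<Rightarrow> state \<Rightarrow> bool" where
  "frame st st' \<longleftrightarrow> (\<forall>x \<in> {''n'', ''s'', ''d'', ''I'', ''K'', ''J''}. fst st' x = fst st x) \<and>
     (\<forall>a < d. snd st' a = snd st a)"

lemma frame_refl: "frame st st"
  by (simp add: frame_def)

lemma frame_trans: "frame st st' \<Longrightarrow> frame st' st'' \<Longrightarrow> frame st st''"
  by (simp add: frame_def)

lemma block_layout_frame: "block_layout I K J C st \<Longrightarrow> frame st st' \<Longrightarrow> block_layout I K J C st'"
  unfolding layout_def frame_def using matrices_cong[of n A B C "snd st" "snd st'"]
  by (auto simp: d)

lemma val_arc_0: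
  assumes "block_layout I K J C st"
  shows "val (arc_0 (Var ''u'') (Var ''v'')) st \<noteq> 0 \<longleftrightarrow> chain_arc s (fst st ''u'') (fst st ''v'')"
  using assms by (auto simp: arc_0_def chain_arc_def layout_def)

lemma val_arc_1:
  assumes "block_layout I K J C st"
  shows "val (arc_1 (Var ''u'') (Var ''v'')) st \<noteq> 0 \<longleftrightarrow>
    layer_arc s (in_blocks n s I K A) (in_blocks n s K J B) (in_blocks n s J I (\<lambda>j i. \<not> C i j))
      (fst st ''u'') (fst st ''v'')"
proof -
  let ?u = "fst st ''u''" and ?v = "fst st ''v''"
  have regs: "fst st ''n'' = n" "fst st ''s'' = s" "fst st ''I'' = I" "fst st ''K'' = K" "fst st ''J'' = J"
    using assms by (auto simp: layout_def)
  have mem: "i < n \<Longrightarrow> j < n \<Longrightarrow> snd st (1 + i * n + j) = of_bool (A i j)"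
      "i < n \<Longrightarrow> j < n \<Longrightarrow> snd st (1 + n * n + i * n + j) = of_bool (B i j)"
      "i < n \<Longrightarrow> j < n \<Longrightarrow> snd st (1 + 2 * n * n + i * n + j) = of_bool (C i j)" for i j
    using assms unfolding layout_def matrices_def by blast+
  have layer:
      "val (layer_to_next 0 (Var ''u'') (Var ''v'')) st = of_bool (?u < s \<and> s \<le> ?v \<and> ?v < 2 * s)"
      "val (layer_to_next 1 (Var ''u'') (Var ''v'')) st =
        of_bool (s \<le> ?u \<and> ?u < 2 * s \<and> 2 * s \<le> ?v \<and> ?v < 3 * s)"
      "val (layer_to_next 2 (Var ''u'') (Var ''v'')) st =
        of_bool (2 * s \<le> ?u \<and> ?u < 3 * s \<and> 3 * s \<le> ?v \<and> ?v < 4 * s)"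
    by (auto simp: layer_to_next_def regs)
  \<comment> \<open>Beyond the matrix the memory content is unknown, but a comparison factor is then
    0 and annihilates the product. The layer condition \<open>b\<close> likewise switches off
    differences that were truncated at 0.\<close>
  have 1: "of_bool b * of_bool (i < n) * of_bool (j < n) * snd st (1 + i * n + j) \<noteq> 0 \<longleftrightarrow>
      b \<and> i < n \<and> j < n \<and> A i j" for b i j
    by (cases "i < n"; cases "j < n"; simp add: mem(1)[simplified])
  have 2: "of_bool b * of_bool (i < n) * of_bool (j < n) * snd st (1 + n * n + i * n + j) \<noteq> 0 \<longleftrightarrow>
      b \<and> i < n \<and> j < n \<and> B i j" for b i j
    by (cases "i < n"; cases "j < n"; simp add: mem(2)[simplified])
  have 3: "of_bool b * of_bool (j < n) * of_bool (i < n) * (1 - snd st (1 + 2 * n * n + i * n + j)) \<noteq> 0 \<longleftrightarrow>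
      b \<and> j < n \<and> i < n \<and> \<not> C i j" for b i j
    by (cases "i < n"; cases "j < n"; simp add: mem(3)[simplified])
  have 4: "of_bool b * of_bool c \<noteq> (0::nat) \<longleftrightarrow> b \<and> c" for b c
    by simp
  show ?thesis
    unfolding arc_1_def Let_def val.simps apply_bop.simps layer in_block_def A_at_def B_at_def C_at_def
      regs add_eq_0_iff_both_eq_0 de_Morgan_conj 1 2 3 4 layer_arc_def in_blocks_def
    by (simp add: conj_assoc)
qed

text \<open>The input area: two node words at \<open>d\<close>, the number of nodes at
  \<open>d + 2\<close>, the position table with \<open>4 * s + 3\<close> entries from
  \<open>d + 3\<close>, the lists from \<open>d + 4 * s + 6\<close>. So far \<open>k\<close> table
  entries are in place and the list entries \<open>L\<close> have been emitted.\<close>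

definition db_written ::
  "state \<Rightarrow> (nat \<times> nat) list list \<Rightarrow> nat \<Rightarrow> (nat \<times> nat) list \<Rightarrow> state \<Rightarrow> bool" where
  "db_written st\<^sub>0 adj k L st \<longleftrightarrow> frame st\<^sub>0 st \<and>
     snd st d = 4 * s \<and> snd st (d + 1) = 4 * s + 1 \<and> snd st (d + 2) = 4 * s + 2 \<and>
     (\<forall>i<k. snd st (d + 3 + i) = length (concat (take i adj))) \<and>
     words (snd st) (d + 4 * s + 6) (flatten L) \<and>
     fst st ''p'' = d + 4 * s + 6 + 2 * length L \<and> fst st ''e'' = length L"

lemma db_written_register:
  "x \<in> {''u'', ''v''} \<Longrightarrow> db_written st\<^sub>0 adj k L (r(x := a), m) \<longleftrightarrow> db_written st\<^sub>0 adj k L (r, m)"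
  by (auto simp: db_written_def frame_def)

lemma db_written_next:
  assumes "db_written st\<^sub>0 adj k L st" "length L = length (concat (take k adj))" "k < 4 * s + 3"
  shows "db_written st\<^sub>0 adj (Suc k) L (fst st, (snd st)(d + 3 + k := length L))"
  using assms by (auto simp: db_written_def frame_def words_update_below less_Suc_eq)

lemma run_emit_arc:
  assumes "db_written st\<^sub>0 adj k L st" "k \<le> 4 * s + 3" "length L < 100 * (s * s)" "a < 10"
    "fst st ''v'' < 10 * s"
  shows "run\<^sub>0 (emit_arc a) st 30 (\<lambda>st'. db_written st\<^sub>0 adj k (L @ [(a, fst st ''v'')]) st' \<and>
    fst st' ''u'' = fst st ''u'' \<and> fst st' ''v'' = fst st ''v'')"
proof -
  note bounds = size_bounds
  have p: "fst st ''p'' = d + 4 * s + 6 + 2 * length L" "fst st ''e'' = length L"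
    using assms(1) by (auto simp: db_written_def)
  have less: "d + 4 * s + 9 + 2 * length L < M" "fst st ''v'' < M" "length L + 1 < M"
    using bounds assms(3,5) s by linarith+
  have "run\<^sub>0 (emit_arc a) st ((6 + cost (Num a)) + ((6 + cost (Var ''v'')) + (1 + cost (Var ''e'' \<^bold>+ Num 1))))
    (\<lambda>st'. db_written st\<^sub>0 adj k (L @ [(a, fst st ''v'')]) st' \<and>
      fst st' ''u'' = fst st ''u'' \<and> fst st' ''v'' = fst st ''v'')"
    unfolding emit_arc_def
  proof (intro run_Seq run_emit bounded_words_axioms run_Assign)
    show "val (Num a) st < M" using assms(4) ten_le_M by simp
  qed (use assms less p in \<open>simp_all add: moderate_def db_written_def frame_def
        flatten_simps words_append words_Cons words_Nil words_update length_flatten\<close>)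
  then show ?thesis by (rule run_mono) simp_all
qed

lemma run_arcs:
  assumes st0: "block_layout I K J C st\<^sub>0"
    and st: "db_written st\<^sub>0 adj k L st" "k \<le> 4 * s + 3" "length L + 2 \<le> 100 * (s * s)"
    and uv: "fst st ''v'' < 4 * s + 2" "fst st ''u'' = u" "fst st ''v'' = v"
  shows "run\<^sub>0 (If (arc_0 (Var ''u'') (Var ''v'')) (emit_arc 0) Skip ;;
       If (arc_1 (Var ''u'') (Var ''v'')) (emit_arc 1) Skip) st 500
     (\<lambda>st'. db_written st\<^sub>0 adj k (L @ block_entries I K J C u v) st' \<and>
        fst st' ''u'' = u \<and> fst st' ''v'' = v)"
proof -
  let ?L0 = "if chain_arc s u v then [(0, v)] else []"
  let ?P = "\<lambda>L st'. db_written st\<^sub>0 adj k L st' \<and> fst st' ''u'' = u \<and> fst st' ''v'' = v"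
  have v: "fst st' ''v'' < 10 * s" if "fst st' ''v'' = v" for st'
    using that uv s by simp
  have layout: "block_layout I K J C st'" if "db_written st\<^sub>0 adj k L st'" for L st'
    using that block_layout_frame[OF st0] by (simp add: db_written_def)
  have cost: "moderate (arc_0 (Var ''u'') (Var ''v''))" "moderate (arc_1 (Var ''u'') (Var ''v''))"
      "cost (arc_0 (Var ''u'') (Var ''v'')) + cost (arc_1 (Var ''u'') (Var ''v'')) \<le> 400"
    by (simp_all add: moderate_def arc_0_def arc_1_def layer_to_next_def in_block_def Let_def
        A_at_def B_at_def C_at_def)
  have step: "run\<^sub>0 (If e (emit_arc a) Skip) st' (1 + cost e + 30) (?P (L' @ (if b then [(a, v)] else [])))"
    if "moderate e" "val e st' \<noteq> 0 \<longleftrightarrow> b" "?P L' st'" "length L' < 100 * (s * s)" "a < 10" for e a b L' st'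
  proof (rule run_If)
    assume "val e st' \<noteq> 0"
    then show "run\<^sub>0 (emit_arc a) st' 30 (?P (L' @ (if b then [(a, v)] else [])))"
      using run_emit_arc[of st\<^sub>0 adj k L' st' a] that st v[of st'] by simp
  next
    assume "val e st' = 0"
    then show "run\<^sub>0 Skip st' 30 (?P (L' @ (if b then [(a, v)] else [])))"
      using that by (intro run_mono[OF run_Skip[of "?P (L' @ (if b then [(a, v)] else []))"]]) simp_all
  qed fact
  have "run\<^sub>0 (If (arc_0 (Var ''u'') (Var ''v'')) (emit_arc 0) Skip ;;
       If (arc_1 (Var ''u'') (Var ''v'')) (emit_arc 1) Skip) st
     ((1 + cost (arc_0 (Var ''u'') (Var ''v'')) + 30) + (1 + cost (arc_1 (Var ''u'') (Var ''v'')) + 30))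
     (?P (L @ block_entries I K J C u v))"
  proof (rule run_Seq, rule run_mono)
    show "run\<^sub>0 (If (arc_0 (Var ''u'') (Var ''v'')) (emit_arc 0) Skip) st
        (1 + cost (arc_0 (Var ''u'') (Var ''v'')) + 30) (?P (L @ ?L0))"
      by (rule step[OF cost(1)]) (use st uv val_arc_0[OF layout[OF st(1)]] in simp_all)
  next
    fix st' assume st': "?P (L @ ?L0) st'"
    have len: "length (L @ ?L0) < 100 * (s * s)" using st(3) by simp
    have arc: "val (arc_1 (Var ''u'') (Var ''v'')) st' \<noteq> 0 \<longleftrightarrow> layer_arc s (in_blocks n s I K A)
        (in_blocks n s K J B) (in_blocks n s J I (\<lambda>j i. \<not> C i j)) u v"
      using val_arc_1[OF layout[of "L @ ?L0" st']] st' by simp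
    show "run\<^sub>0 (If (arc_1 (Var ''u'') (Var ''v'')) (emit_arc 1) Skip) st'
        (1 + cost (arc_1 (Var ''u'') (Var ''v'')) + 30) (?P (L @ block_entries I K J C u v))"
      using step[OF cost(2) arc st' len, of 1] by (simp add: arc_entries_def)
  qed simp
  then show ?thesis by (rule run_mono) (use cost in auto)
qed

lemma run_write_db:
  assumes st0: "block_layout I K J C st\<^sub>0"
  shows "run\<^sub>0 write_db st\<^sub>0 (20000 * (s * s)) (\<lambda>st.
    frame st\<^sub>0 st \<and>
    words (snd st) d (4 * s # (4 * s + 1) # adjacency_words (block_adjacency I K J C)) \<and>
    fst st ''p'' = d + 2 + length (adjacency_words (block_adjacency I K J C)) \<and>
    fst st ''p'' \<le> d + 200 * (s * s))"
proof -
  let ?adj = "block_adjacency I K J C"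
  let ?N = "4 * s + 2"
  let ?e = "Num 4 \<^bold>* vs \<^bold>+ Num 2"
  let ?W = "db_written st\<^sub>0 ?adj"
  have N: "?N < M" "?N * (2 * ?N) \<le> 72 * (s * s)"
  proof -
    show "?N < M" using size_bounds s by linarith
    \<comment> \<open>Each ordered pair of nodes contributes at most two entries, and
      \<open>4 * s + 2 \<le> 6 * s\<close> since \<open>1 \<le> s\<close>; hence the 72.\<close>
    have "?N * (2 * ?N) \<le> (6 * s) * (2 * (6 * s))" using s by (intro mult_le_mono) auto
    then show "?N * (2 * ?N) \<le> 72 * (s * s)" by simp
  qed
  have small: "d + 3 + ?N < M" "7 + (d + 4 * s) < M" using size_bounds s by linarith+
  have e: "moderate ?e" "cost ?e = 5" by (simp_all add: moderate_def)
  have ve: "val ?e st = ?N" if "?W k L st" for k L st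
    using that st0 by (simp add: db_written_def frame_def layout_def)
  have entries: "length (concat (take k ?adj)) \<le> k * (2 * ?N)" if "k \<le> ?N" for k
    using length_concat_gadget_adjacency[OF that] .
  have entries_bound: "length (concat (take k ?adj)) \<le> 72 * (s * s)" if "k \<le> ?N" for k
    using le_trans[OF entries[OF that] le_trans[OF mult_le_mono1[OF that] N(2)]] .
  have inner: "run\<^sub>0 (For ''v'' ?e
       (If (arc_0 (Var ''u'') (Var ''v'')) (emit_arc 0) Skip ;;
        If (arc_1 (Var ''u'') (Var ''v'')) (emit_arc 1) Skip)) st (?N * (500 + 5 + 7) + 5 + 5)
     (\<lambda>st'. ?W (Suc u) (concat (take (Suc u) ?adj)) st' \<and> fst st' ''u'' = u)"
    if st: "?W (Suc u) (concat (take u ?adj)) st" "fst st ''u'' = u" and u: "u < ?N" for st u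
  proof -
    let ?L = "\<lambda>i. concat (take u ?adj) @ concat (map (block_entries I K J C u) [0..<i])"
    let ?Inv = "\<lambda>i st'. ?W (Suc u) (?L i) st' \<and> fst st' ''u'' = u"
    have "run\<^sub>0 (For ''v'' ?e
       (If (arc_0 (Var ''u'') (Var ''v'')) (emit_arc 0) Skip ;;
        If (arc_1 (Var ''u'') (Var ''v'')) (emit_arc 1) Skip)) st (?N * (500 + cost ?e + 7) + cost ?e + 5)
       (?Inv ?N)"
    proof (rule run_For[where Inv = ?Inv])
      fix i st' assume st': "?Inv i st'" "i < ?N" "fst st' ''v'' = i"
      have "length (?L i) \<le> u * (2 * ?N) + 2 * i"
        using entries[of u] u length_concat_arc_entries[where k = i] by (simp add: add_mono)
      also have "\<dots> \<le> u * (2 * ?N) + 2 * ?N" using st'(2) by simp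
      also have "\<dots> = Suc u * (2 * ?N)" by simp
      also have "\<dots> \<le> ?N * (2 * ?N)" using u by (intro mult_le_mono1) simp
      finally have "length (?L i) + 2 \<le> 100 * (s * s)" using N size_bounds s by linarith
      note arcs = run_arcs[OF st0 _ _ this, of ?adj "Suc u" st' u i]
      show "run\<^sub>0 (If (arc_0 (Var ''u'') (Var ''v'')) (emit_arc 0) Skip ;;
          If (arc_1 (Var ''u'') (Var ''v'')) (emit_arc 1) Skip) st' 500
          (\<lambda>s'. fst s' ''v'' = i \<and> ?Inv (Suc i) ((fst s')(''v'' := Suc i), snd s'))"
        by (rule run_mono[OF arcs]) (use st' u in \<open>auto simp: db_written_register\<close>)
    qed (use st N e ve in \<open>auto simp: db_written_register\<close>)
    \<comment> \<open>Once all targets have been scanned, the list under construction is list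
      \<open>u\<close> in full.\<close>
    moreover have "?L ?N = concat (take (Suc u) ?adj)"
      using u by (simp add: take_Suc_conv_app_nth nth_gadget_adjacency length_gadget_adjacency
          del: upt_Suc)
    ultimately show ?thesis using e(2) by simp
  qed
  have body: "run\<^sub>0 (Store (vd \<^bold>+ Num 3 \<^bold>+ Var ''u'') (Var ''e'') ;; For ''v'' ?e
       (If (arc_0 (Var ''u'') (Var ''v'')) (emit_arc 0) Skip ;;
        If (arc_1 (Var ''u'') (Var ''v'')) (emit_arc 1) Skip)) st (?N * 512 + 20)
     (\<lambda>st'. fst st' ''u'' = u \<and> ?W (Suc u) (concat (take (Suc u) ?adj)) ((fst st')(''u'' := Suc u), snd st'))"
    if st: "?W u (concat (take u ?adj)) st" "fst st ''u'' = u" and u: "u < ?N" for st u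
  proof -
    have "run\<^sub>0 (Store (vd \<^bold>+ Num 3 \<^bold>+ Var ''u'') (Var ''e'') ;; For ''v'' ?e
       (If (arc_0 (Var ''u'') (Var ''v'')) (emit_arc 0) Skip ;;
        If (arc_1 (Var ''u'') (Var ''v'')) (emit_arc 1) Skip)) st
       ((1 + cost (vd \<^bold>+ Num 3 \<^bold>+ Var ''u'') + cost (Var ''e'')) + (?N * (500 + 5 + 7) + 5 + 5))
     (\<lambda>st'. ?W (Suc u) (concat (take (Suc u) ?adj)) st' \<and> fst st' ''u'' = u)"
    proof (intro run_Seq run_Store inner)
      have "fst st ''e'' \<le> 72 * (s * s)"
        using st entries_bound[of u] u by (simp add: db_written_def)
      then show "val (Var ''e'') st < M" using size_bounds(5) by simp
      have vals: "val (vd \<^bold>+ Num 3 \<^bold>+ Var ''u'') st = d + 3 + u"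
          "val (Var ''e'') st = length (concat (take u ?adj))"
        using st st0 by (auto simp: db_written_def frame_def layout_def)
      show "?W (Suc u) (concat (take u ?adj))
          (fst st, (snd st)(val (vd \<^bold>+ Num 3 \<^bold>+ Var ''u'') st := val (Var ''e'') st))"
        unfolding vals using db_written_next[OF st(1)] u by simp
    qed (use st u in \<open>auto simp: moderate_def\<close>)
    then show ?thesis by (rule run_mono) (auto simp: db_written_register)
  qed
  have regs: "fst st\<^sub>0 ''d'' = d" "fst st\<^sub>0 ''s'' = s" using st0 by (auto simp: layout_def)
  have outer: "run\<^sub>0 (For ''u'' ?e
      (Store (vd \<^bold>+ Num 3 \<^bold>+ Var ''u'') (Var ''e'') ;; For ''v'' ?e
       (If (arc_0 (Var ''u'') (Var ''v'')) (emit_arc 0) Skip ;;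
        If (arc_1 (Var ''u'') (Var ''v'')) (emit_arc 1) Skip))) st
      (?N * (?N * 512 + 20 + cost ?e + 7) + cost ?e + 5) (?W ?N (concat ?adj))"
    if "?W 0 [] st" for st
  proof (rule run_For[where Inv = "\<lambda>i. ?W i (concat (take i ?adj))"])
  qed (use that N e ve body in \<open>auto simp: db_written_register length_gadget_adjacency\<close>)
  have "run\<^sub>0 write_db st\<^sub>0 ((1 + cost vd + cost (Num 4 \<^bold>* vs)) +
      ((1 + cost (vd \<^bold>+ Num 1) + cost (Num 4 \<^bold>* vs \<^bold>+ Num 1)) +
      ((1 + cost (vd \<^bold>+ Num 2) + cost (Num 4 \<^bold>* vs \<^bold>+ Num 2)) +
      ((1 + cost (vd \<^bold>+ Num 4 \<^bold>* vs \<^bold>+ Num 6)) + ((1 + cost (Num 0)) +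
      ((?N * (?N * 512 + 20 + cost ?e + 7) + cost ?e + 5) +
      (1 + cost (vd \<^bold>+ Num 4 \<^bold>* vs \<^bold>+ Num 5) + cost (Var ''e''))))))))
      (?W (4 * s + 3) (concat ?adj))"
    unfolding write_db_def
  proof (intro run_Seq run_Store run_Assign, goal_cases)
    \<comment> \<open>The thirteen goals before this one are side conditions of the three stores and
      two assignments; this one is the outer loop with the final store behind it.\<close>
    case 14
    show ?case
    proof (rule run_mono[OF outer], goal_cases)
      case 1
      show ?case using regs
        by (simp add: db_written_def frame_def flatten_simps words_Nil)
    next
      case 2
      show ?case by simp
    next
      case (3 st)
      note st = this
      have len: "length (concat ?adj) \<le> 72 * (s * s)"
        using entries_bound[of ?N] by (simp add: length_gadget_adjacency)
      have vals: "val (vd \<^bold>+ Num 4 \<^bold>* vs \<^bold>+ Num 5) st = d + 3 + ?N"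
          "val (Var ''e'') st = length (concat ?adj)"
        using st regs by (auto simp: db_written_def frame_def)
      \<comment> \<open>The table has one entry more than there are nodes: the total number of list
        entries, known only after the loop.\<close>
      have "?W (Suc ?N) (concat ?adj) (fst st, (snd st)(d + 3 + ?N := length (concat ?adj)))"
        by (rule db_written_next[OF st]) (simp_all add: length_gadget_adjacency)
      moreover have "Suc ?N = 4 * s + 3" by simp
      ultimately have W: "?W (4 * s + 3) (concat ?adj)
          (fst st, (snd st)(d + 3 + ?N := length (concat ?adj)))"
        by (simp only:)
      show ?case
      proof (rule run_Store)
        show "val (Var ''e'') st < M" unfolding vals using len size_bounds(5) by linarith
        show "?W (4 * s + 3) (concat ?adj)
            (fst st, (snd st)(val (vd \<^bold>+ Num 4 \<^bold>* vs \<^bold>+ Num 5) st := val (Var ''e'') st))"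
          unfolding vals by (rule W)
      qed (simp_all add: moderate_def)
    qed
  qed (use regs small in \<open>auto simp: moderate_def\<close>)
  then show ?thesis
  proof (rule run_mono)
    have "?N * (?N * 512 + 32) \<le> (6 * s) * ((6 * s) * 512 + 32)" using s by (intro mult_le_mono add_mono) auto
    also have "\<dots> = 18432 * (s * s) + 192 * s" by (simp add: algebra_simps)
    finally have "?N * (?N * 512 + 32) + 80 \<le> 20000 * (s * s)" using size_bounds(1) s by linarith
    then show "(1 + cost vd + cost (Num 4 \<^bold>* vs)) +
      ((1 + cost (vd \<^bold>+ Num 1) + cost (Num 4 \<^bold>* vs \<^bold>+ Num 1)) +
      ((1 + cost (vd \<^bold>+ Num 2) + cost (Num 4 \<^bold>* vs \<^bold>+ Num 2)) +
      ((1 + cost (vd \<^bold>+ Num 4 \<^bold>* vs \<^bold>+ Num 6)) + ((1 + cost (Num 0)) +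
      ((?N * (?N * 512 + 20 + cost ?e + 7) + cost ?e + 5) +
      (1 + cost (vd \<^bold>+ Num 4 \<^bold>* vs \<^bold>+ Num 5) + cost (Var ''e''))))))) \<le> 20000 * (s * s)"
      by simp
  next
    fix st assume st: "?W (4 * s + 3) (concat ?adj) st"
    have "length (concat ?adj) \<le> 72 * (s * s)"
      using entries_bound[of ?N] by (simp add: length_gadget_adjacency)
    moreover have "fst st ''p'' = d + 4 * s + 6 + 2 * length (concat ?adj)"
      using st by (simp add: db_written_def)
    ultimately have "fst st ''p'' \<le> d + 200 * (s * s)" using size_bounds(1) s by linarith
    moreover have "words (snd st) (d + 3) (map (\<lambda>u. length (concat (take u ?adj))) [0..<Suc (length ?adj)])"
      using st by (simp add: words_def db_written_def length_gadget_adjacency del: upt_Suc)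
    moreover have six: "d + (6 + 4 * s) = Suc (Suc (Suc (Suc (Suc (Suc (d + 4 * s))))))"
      by simp
    ultimately show "frame st\<^sub>0 st \<and>
        words (snd st) d (4 * s # (4 * s + 1) # adjacency_words ?adj) \<and>
        fst st ''p'' = d + 2 + length (adjacency_words ?adj) \<and> fst st ''p'' \<le> d + 200 * (s * s)"
      using st unfolding db_written_def adjacency_words_def flatten_def[symmetric]
      by (simp add: words_Cons words_append length_flatten length_gadget_adjacency
          numeral_3_eq_3 add_ac six del: upt_Suc)
  qed
qed

section \<open>Writing the query\<close>

definition appended :: "state \<Rightarrow> nat list \<Rightarrow> state \<Rightarrow> bool" where
  "appended st\<^sub>0 ws st \<longleftrightarrow> frame st\<^sub>0 st \<and> (\<forall>a < fst st\<^sub>0 ''p''. snd st a = snd st\<^sub>0 a) \<and>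
     words (snd st) (fst st\<^sub>0 ''p'') ws \<and> fst st ''p'' = fst st\<^sub>0 ''p'' + length ws"

lemma appended_register: "appended st\<^sub>0 ws (r(''u'' := a), m) \<longleftrightarrow> appended st\<^sub>0 ws (r, m)"
  by (simp add: appended_def frame_def)

lemma run_emit_Num:
  assumes "appended st\<^sub>0 ws st" "k < 10" "d \<le> fst st\<^sub>0 ''p''" "fst st\<^sub>0 ''p'' + length ws + 1 < M"
  shows "run\<^sub>0 (emit (Num k)) st 7 (\<lambda>st'. appended st\<^sub>0 (ws @ [k]) st' \<and> fst st' ''u'' = fst st ''u'')"
proof -
  have "run\<^sub>0 (emit (Num k)) st (6 + cost (Num k))
      (\<lambda>st'. appended st\<^sub>0 (ws @ [k]) st' \<and> fst st' ''u'' = fst st ''u'')"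
    by (intro run_emit bounded_words_axioms)
      (use assms ten_le_M in \<open>auto simp: moderate_def appended_def frame_def words_append words_Cons
        words_Nil words_update\<close>)
  then show ?thesis by simp
qed

lemma run_emit_Num_Seq:
  assumes "appended st\<^sub>0 ws st" "k < 10" "d \<le> fst st\<^sub>0 ''p''" "fst st\<^sub>0 ''p'' + length ws + 1 < M"
    and "\<And>st'. appended st\<^sub>0 (ws @ [k]) st' \<Longrightarrow> fst st' ''u'' = fst st ''u'' \<Longrightarrow> run\<^sub>0 c st' T Q"
  shows "run\<^sub>0 (emit (Num k) ;; c) st (7 + T) Q"
  by (intro run_Seq run_mono[OF run_emit_Num[OF assms(1-4)]]) (use assms(5) in auto)

lemma run_write_query:
  assumes p: "d \<le> fst st\<^sub>0 ''p''" "fst st\<^sub>0 ''p'' + 30 * s < M" and s_reg: "fst st\<^sub>0 ''s'' = s"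
  shows "run\<^sub>0 write_query st\<^sub>0 (500 * s)
    (\<lambda>st. appended st\<^sub>0 (rpq_words (gadget_query s)) st)"
proof -
  let ?b = "[2, 1, 5, 1, 5, 5, 1, 4, 1] :: nat list"
  let ?A = "appended st\<^sub>0"
  \<comment> \<open>The words \<open>[1, 5, 1]\<close> open the outer
    \<open>Concat b (Concat\<close> of \<open>gadget_query\<close>. The levels, the core
    \<open>bbb\<close> and the closing letters follow as in \<open>rpq_words_nested_query\<close>,
    and one last letter 1 ends the query.\<close>
  let ?ws1 = "\<lambda>i. [1, 5, 1] @ concat (replicate i ?b)"
  let ?ws2 = "\<lambda>i. (?ws1 s @ [1, 5, 1, 5, 5]) @ replicate i 4"
  have vs: "val vs st = s" if "?A ws st" for ws st
    using that s_reg by (simp add: appended_def frame_def)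
  have len: "length (?ws1 i) = 3 + 9 * i" for i by (induction i) auto
  have len2: "length (?ws2 i) = 8 + 9 * s + i" for i using len[of s] by simp
  have e: "moderate vs" "cost vs = 1" "s < M" using p s by (auto simp: moderate_def)
  have start: "?A [] st\<^sub>0" by (simp add: appended_def frame_refl words_Nil)
  have body1: "run\<^sub>0
        (emit (Num 2) ;;
         emit (Num 1) ;; emit (Num 5) ;; emit (Num 1) ;; emit (Num 5) ;; emit (Num 5) ;;
         emit (Num 1) ;; emit (Num 4) ;; emit (Num 1)) st 63
        (\<lambda>st'. ?A (?ws1 i @ ?b) st' \<and> fst st' ''u'' = i)"
    if "?A (?ws1 i) st" "i < s" "fst st ''u'' = i" for i st
  proof -
    have "fst st\<^sub>0 ''p'' + length (?ws1 i) + 10 < M" using len[of i] p that(2) by linarith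
    then have "run\<^sub>0
        (emit (Num 2) ;;
         emit (Num 1) ;; emit (Num 5) ;; emit (Num 1) ;; emit (Num 5) ;; emit (Num 5) ;;
         emit (Num 1) ;; emit (Num 4) ;; emit (Num 1)) st
        (7 + (7 + (7 + (7 + (7 + (7 + (7 + (7 + 7))))))))
        (\<lambda>st'. ?A (?ws1 i @ ?b) st' \<and> fst st' ''u'' = i)"
      using that p
      by - ((rule run_emit_Num_Seq, assumption, simp, simp, simp)+,
        rule run_mono[OF run_emit_Num], assumption, simp_all)
    then show ?thesis by simp
  qed
  have loop1: "run\<^sub>0 (For ''u'' vs
        (emit (Num 2) ;;
         emit (Num 1) ;; emit (Num 5) ;; emit (Num 1) ;; emit (Num 5) ;; emit (Num 5) ;;
         emit (Num 1) ;; emit (Num 4) ;; emit (Num 1))) st (s * (63 + cost vs + 7) + cost vs + 5)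
        (?A (?ws1 s))"
    if "?A [1, 5, 1] st" for st
  proof (rule run_For[where Inv = "\<lambda>i. ?A (?ws1 i)"])
    fix i st assume "?A (?ws1 i) st" "i < s" "fst st ''u'' = i"
    note body1[OF this]
    moreover have "concat (replicate i w) @ w = concat (replicate (Suc i) w)" for w :: "nat list"
      by (induction i) simp_all
    then have "?ws1 i @ ?b = ?ws1 (Suc i)" by simp
    ultimately show "run\<^sub>0 (emit (Num 2) ;;
         emit (Num 1) ;; emit (Num 5) ;; emit (Num 1) ;; emit (Num 5) ;; emit (Num 5) ;;
         emit (Num 1) ;; emit (Num 4) ;; emit (Num 1)) st 63
         (\<lambda>s'. fst s' ''u'' = i \<and> ?A (?ws1 (Suc i)) ((fst s')(''u'' := Suc i), snd s'))"
      by (simp only: appended_register prod.collapse conj_commute)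
  qed (use that e vs in \<open>auto simp: appended_register\<close>)
  have loop2: "run\<^sub>0 (For ''u'' vs (emit (Num 4))) st (s * (7 + cost vs + 7) + cost vs + 5) (?A (?ws2 s))"
    if "?A (?ws2 0) st" for st
  proof (rule run_For[where Inv = "\<lambda>i. ?A (?ws2 i)"])
    fix i st assume st: "?A (?ws2 i) st" "i < s" "fst st ''u'' = i"
    have "fst st\<^sub>0 ''p'' + length (?ws2 i) + 1 < M" using len2[of i] p st(2) by linarith
    from run_emit_Num[OF st(1) _ p(1) this, of 4]
    have "run\<^sub>0 (emit (Num 4)) st 7 (\<lambda>s'. ?A (?ws2 i @ [4]) s' \<and> fst s' ''u'' = i)"
      using st(3) by simp
    moreover have "?ws2 i @ [4] = ?ws2 (Suc i)" by (simp add: replicate_append_same)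
    ultimately show "run\<^sub>0 (emit (Num 4)) st 7
        (\<lambda>s'. fst s' ''u'' = i \<and> ?A (?ws2 (Suc i)) ((fst s')(''u'' := Suc i), snd s'))"
      by (simp only: appended_register prod.collapse conj_commute)
  qed (use that e vs in \<open>auto simp: appended_register\<close>)
  have last: "run\<^sub>0 (emit (Num 5)) st 7 (?A (rpq_words (gadget_query s)))" if "?A (?ws2 s) st" for st
  proof -
    have "fst st\<^sub>0 ''p'' + length (?ws2 s) + 1 < M" using len2[of s] p s by linarith
    from run_emit_Num[OF that _ p(1) this, of 5]
    have "run\<^sub>0 (emit (Num 5)) st 7 (?A (?ws2 s @ [5]))" by (rule run_mono) simp_all
    moreover have "?ws2 s @ [5] = rpq_words (gadget_query s)"
      by (simp add: gadget_query_def rpq_words_nested_query)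
    ultimately show ?thesis by simp
  qed
  have mid: "run\<^sub>0 (emit (Num 1) ;; emit (Num 5) ;; emit (Num 1) ;; emit (Num 5) ;; emit (Num 5) ;;
      For ''u'' vs (emit (Num 4)) ;; emit (Num 5)) st
      (7 + (7 + (7 + (7 + (7 + ((s * (7 + cost vs + 7) + cost vs + 5) + 7))))))
      (?A (rpq_words (gadget_query s)))" if st: "?A (?ws1 s) st" for st
  proof -
    have "fst st\<^sub>0 ''p'' + length (?ws1 s) + 10 < M" using len[of s] p s by linarith
    moreover have "run\<^sub>0 (For ''u'' vs (emit (Num 4)) ;; emit (Num 5)) st'
        ((s * (7 + cost vs + 7) + cost vs + 5) + 7) (?A (rpq_words (gadget_query s)))"
      if "?A (((((?ws1 s @ [1]) @ [5]) @ [1]) @ [5]) @ [5]) st'" for st'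
      by (rule run_Seq, rule run_mono[OF loop2]) (use that last in simp_all)
    ultimately show ?thesis
      using st p
      by - ((rule run_emit_Num_Seq, assumption, simp, simp, simp)+, blast)
  qed
  have "run\<^sub>0 write_query st\<^sub>0 (7 + (7 + (7 + ((s * (63 + cost vs + 7) + cost vs + 5) +
      (7 + (7 + (7 + (7 + (7 + ((s * (7 + cost vs + 7) + cost vs + 5) + 7))))))))))
      (?A (rpq_words (gadget_query s)))"
  proof -
    have "fst st\<^sub>0 ''p'' + 10 < M" using p s by linarith
    then show ?thesis
    unfolding write_query_def
    using start p
    by - ((rule run_emit_Num_Seq, assumption, simp, simp, simp)+,
      rule run_Seq, rule run_mono[OF loop1], simp, simp, rule mid)
  qed
  then show ?thesis by (rule run_mono) (use s in simp_all)
qed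

end

section \<open>The search\<close>

lemma row_major_inj:
  assumes "i * n + j = i' * n + j'" "j < n" "j' < (n::nat)"
  shows "i = i'" "j = j'"
proof -
  have "(i * n + j) div n = i" "(i' * n + j') div n = i'" using assms(2,3) by auto
  then show "i = i'" using assms(1) by simp
  then show "j = j'" using assms(1) by simp
qed

lemma matrices_set_entry:
  assumes "matrices n A B C m" "i < n" "j < n"
  shows "matrices n A B (\<lambda>i' j'. C i' j' \<or> i' = i \<and> j' = j) (m(1 + 2 * n * n + i * n + j := 1))"
  unfolding matrices_def
proof (intro allI impI)
  fix i' j' assume ij: "i' < n" "j' < n"
  have "i * n + j < n * n" "i' * n + j' < n * n" using ij assms by (auto intro: row_major_less)
  then have "1 + i' * n + j' \<noteq> 1 + 2 * n * n + i * n + j"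
      "1 + n * n + i' * n + j' \<noteq> 1 + 2 * n * n + i * n + j" by linarith+
  moreover have "1 + 2 * n * n + i' * n + j' = 1 + 2 * n * n + i * n + j \<longleftrightarrow> i' = i \<and> j' = j"
    using row_major_inj[of i' n j' i j] ij assms(3) by auto
  ultimately show "(m(1 + 2 * n * n + i * n + j := 1)) (1 + i' * n + j') = of_bool (A i' j') \<and>
     (m(1 + 2 * n * n + i * n + j := 1)) (1 + n * n + i' * n + j') = of_bool (B i' j') \<and>
     (m(1 + 2 * n * n + i * n + j := 1)) (1 + 2 * n * n + i' * n + j') =
       of_bool (C i' j' \<or> i' = i \<and> j' = j)"
    using assms(1) ij unfolding matrices_def fun_upd_def by auto
qed

context search_setting
begin

lemma layout_Cons: "layout ((x, k) # \<rho>) C st \<longleftrightarrow> fst st x = k \<and> layout \<rho> C st"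
  by (auto simp: layout_def)

lemma layout_register:
  assumes "x \<notin> {''n'', ''s'', ''d''}" "x \<notin> fst ` set \<rho>"
  shows "layout \<rho> C (r(x := a), m) \<longleftrightarrow> layout \<rho> C (r, m)"
proof -
  have "y \<noteq> x" if "(y, k) \<in> set \<rho>" for y k using that assms(2) by force
  then have "(\<forall>(y, k) \<in> set \<rho>. (r(x := a)) y = k) \<longleftrightarrow> (\<forall>(y, k) \<in> set \<rho>. r y = k)" by auto
  moreover have "''n'' \<noteq> x" "''s'' \<noteq> x" "''d'' \<noteq> x" using assms(1) by auto
  ultimately show ?thesis by (simp add: layout_def)
qed

text \<open>One half of correctness, kept throughout the program. The other half is that in the end
  all triples of blocks satisfy \<open>covers_block\<close>.\<close>

definition sound :: "(nat \<Rightarrow> nat \<Rightarrow> bool) \<Rightarrow> bool" where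
  "sound C \<longleftrightarrow> (\<forall>i<n. \<forall>j<n. C i j \<longrightarrow> (\<exists>k<n. A i k \<and> B k j))"

text \<open>
  The matrix \<open>C\<close> only grows during the search, hence goals \<open>G\<close> that are monotone in \<open>C\<close>, once
  reached, persist through all later iterations of the surrounding loops.
\<close>

definition grown ::
  "(string \<times> nat) list \<Rightarrow> (nat \<Rightarrow> nat \<Rightarrow> bool) \<Rightarrow> ((nat \<Rightarrow> nat \<Rightarrow> bool) \<Rightarrow> bool) \<Rightarrow> state \<Rightarrow> bool"
where
  "grown \<rho> C G st \<longleftrightarrow> (\<exists>C'. C \<le> C' \<and> sound C' \<and> layout \<rho> C' st \<and> G C')"

text \<open>The body is assumed correct from every sound \<open>C\<close>, as each iteration finds
  the matrix left by the earlier ones. The counter belongs to \<open>\<rho>\<close> only inside the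
  body, where its value is fixed.\<close>

lemma run_For_grown:
  assumes e: "moderate e" "cost e \<le> 900" "N < M"
    and x: "x \<notin> {''n'', ''s'', ''d''}" "x \<notin> fst ` set \<rho>"
    and \<Phi>: "\<And>r m k. \<Phi> (r(x := k), m) = \<Phi> (r, m)"
    and val: "\<And>C st. layout \<rho> C st \<Longrightarrow> val e st = N"
    and mono: "\<And>i C C'. C \<le> C' \<Longrightarrow> G i C \<Longrightarrow> G i C'"
    and body: "\<And>i C st. i < N \<Longrightarrow> sound C \<Longrightarrow> layout ((x, i) # \<rho>) C st \<Longrightarrow>
      run \<Phi> c st T (grown ((x, i) # \<rho>) C (G i))"
    and st: "sound C" "layout \<rho> C st"
  shows "run \<Phi> (For x e c) st (N * (T + cost e + 7) + cost e + 5)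
    (grown \<rho> C (\<lambda>C'. \<forall>i<N. G i C'))"
proof (rule run_For[where Inv = "\<lambda>i. grown \<rho> C (\<lambda>C'. \<forall>i'<i. G i' C')"])
  show "grown \<rho> C (\<lambda>C'. \<forall>i'<0. G i' C') ((fst st)(x := 0), snd st)"
    using st layout_register[OF x, of C "fst st" 0 "snd st"] by (auto simp: grown_def)
next
  fix i st assume "grown \<rho> C (\<lambda>C'. \<forall>i'<i. G i' C') st" "i < N" "fst st x = i"
  then obtain C1 where C1: "C \<le> C1" "sound C1" "layout \<rho> C1 st" "\<forall>i'<i. G i' C1"
    by (auto simp: grown_def)
  have "run \<Phi> c st T (grown ((x, i) # \<rho>) C1 (G i))"
    using C1 \<open>i < N\<close> \<open>fst st x = i\<close> by (intro body) (auto simp: layout_Cons)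
  then show "run \<Phi> c st T (\<lambda>s'. fst s' x = i \<and>
      grown \<rho> C (\<lambda>C'. \<forall>i'<Suc i. G i' C') ((fst s')(x := Suc i), snd s'))"
  proof (rule run_mono)
    fix s' assume "grown ((x, i) # \<rho>) C1 (G i) s'"
    then obtain C2 where C2: "C1 \<le> C2" "sound C2" "fst s' x = i" "layout \<rho> C2 s'" "G i C2"
      by (auto simp: grown_def layout_Cons)
    have "\<forall>i'<Suc i. G i' C2" using C1(4) C2(1,5) mono by (auto simp: less_Suc_eq)
    moreover have "layout \<rho> C2 ((fst s')(x := Suc i), snd s')"
      using C2(4) layout_register[OF x, of C2 "fst s'" "Suc i" "snd s'"] by simp
    ultimately show "fst s' x = i \<and>
        grown \<rho> C (\<lambda>C'. \<forall>i'<Suc i. G i' C') ((fst s')(x := Suc i), snd s')"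
      using C2 order_trans[OF C1(1) C2(1)] unfolding grown_def by blast
  qed simp
next
  fix i st assume "grown \<rho> C (\<lambda>C'. \<forall>i'<i. G i' C') st"
  then obtain C' where "layout \<rho> C' st" by (auto simp: grown_def)
  then show "val e st = N" by (rule val)
qed (fact e \<Phi> | assumption)+

section \<open>Exhaustive search in one triple of blocks\<close>

definition covers :: "nat \<Rightarrow> nat \<Rightarrow> nat \<Rightarrow> nat \<Rightarrow> nat \<Rightarrow> nat \<Rightarrow> (nat \<Rightarrow> nat \<Rightarrow> bool) \<Rightarrow> bool" where
  "covers I K J x y z C \<longleftrightarrow> (let i = I * s + x; k = K * s + y; j = J * s + z in
     i < n \<and> k < n \<and> j < n \<and> A i k \<and> B k j \<longrightarrow> C i j)"

definition covers_block :: "nat \<Rightarrow> nat \<Rightarrow> nat \<Rightarrow> (nat \<Rightarrow> nat \<Rightarrow> bool) \<Rightarrow> bool" where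
  "covers_block I K J C \<longleftrightarrow> (\<forall>x<s. \<forall>y<s. \<forall>z<s. covers I K J x y z C)"

lemma covers_mono: "C \<le> C' \<Longrightarrow> covers I K J x y z C \<Longrightarrow> covers I K J x y z C'"
  by (auto simp: covers_def Let_def le_fun_def)

lemma covers_block_mono: "C \<le> C' \<Longrightarrow> covers_block I K J C \<Longrightarrow> covers_block I K J C'"
  using covers_mono[of C C'] unfolding covers_block_def by blast

lemma run_search_entry:
  assumes C: "sound C"
    and st: "layout [(''w'', z), (''v'', y), (''u'', x), (''J'', J), (''K'', K), (''I'', I)] C st"
      (is "layout ?\<rho> C st")
  shows "run\<^sub>0 (let i = in_block ''I'' (Var ''u''); k = in_block ''K'' (Var ''v'');
            j = in_block ''J'' (Var ''w'') in
          If ((i \<^bold>< vn) \<^bold>* (k \<^bold>< vn) \<^bold>* (j \<^bold>< vn) \<^bold>* Mem (A_at i k) \<^bold>* Mem (B_at k j))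
            (Store (C_at i j) (Num 1)) Skip) st 200
     (grown [(''w'', z), (''v'', y), (''u'', x), (''J'', J), (''K'', K), (''I'', I)] C (covers I K J x y z))"
proof -
  define i k j where ikj: "i = I * s + x" "k = K * s + y" "j = J * s + z"
  let ?i = "in_block ''I'' (Var ''u'')" and ?k = "in_block ''K'' (Var ''v'')"
    and ?j = "in_block ''J'' (Var ''w'')"
  let ?e = "(?i \<^bold>< vn) \<^bold>* (?k \<^bold>< vn) \<^bold>* (?j \<^bold>< vn) \<^bold>* Mem (A_at ?i ?k) \<^bold>* Mem (B_at ?k ?j)"
  have vals: "val ?i st = i" "val ?k st = k" "val ?j st = j" "fst st ''n'' = n"
    using st by (auto simp: layout_def in_block_def ikj)
  have mat: "matrices n A B C (snd st)" using st by (simp add: layout_def)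
  have mem: "i < n \<Longrightarrow> k < n \<Longrightarrow> snd st (1 + i * n + k) = of_bool (A i k)"
      "k < n \<Longrightarrow> j < n \<Longrightarrow> snd st (1 + n * n + k * n + j) = of_bool (B k j)"
    using mat unfolding matrices_def by blast+
  have cond: "val ?e st \<noteq> 0 \<longleftrightarrow> i < n \<and> k < n \<and> j < n \<and> A i k \<and> B k j"
  proof (cases "i < n \<and> k < n \<and> j < n")
    case True
    then show ?thesis using mem by (simp add: vals A_at_def B_at_def)
  next
    case False
    then show ?thesis by (auto simp: vals)
  qed
  have C_addr: "val (C_at ?i ?j) st = 1 + 2 * n * n + i * n + j"
    by (simp add: C_at_def vals)
  have "run\<^sub>0 (If ?e (Store (C_at ?i ?j) (Num 1)) Skip) st (1 + cost ?e + 100)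
      (grown ?\<rho> C (covers I K J x y z))"
  proof (rule run_If)
    show "moderate ?e" by (simp add: moderate_def in_block_def A_at_def B_at_def)
  next
    assume "val ?e st \<noteq> 0"
    then have ikj': "i < n" "k < n" "j < n" "A i k" "B k j" using cond by auto
    let ?C = "\<lambda>i' j'. C i' j' \<or> i' = i \<and> j' = j"
    have "sound ?C" using C ikj' unfolding sound_def by blast
    moreover have "layout ?\<rho> ?C (fst st, (snd st)(1 + 2 * n * n + i * n + j := 1))"
      using st matrices_set_entry[OF mat ikj'(1,3)] by (simp add: layout_def)
    ultimately have "grown ?\<rho> C (covers I K J x y z) (fst st, (snd st)(1 + 2 * n * n + i * n + j := 1))"
      unfolding grown_def by (intro exI[of _ ?C]) (auto simp: covers_def ikj le_fun_def)
    then have "run\<^sub>0 (Store (C_at ?i ?j) (Num 1)) st (1 + cost (C_at ?i ?j) + cost (Num 1))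
        (grown ?\<rho> C (covers I K J x y z))"
      using ten_le_M by (intro run_Store; (unfold C_addr)?)
        (simp_all add: moderate_def C_at_def in_block_def)
    then show "run\<^sub>0 (Store (C_at ?i ?j) (Num 1)) st 100 (grown ?\<rho> C (covers I K J x y z))"
      by (rule run_mono) (simp_all add: C_at_def in_block_def)
  next
    assume "val ?e st = 0"
    then have "\<not> (i < n \<and> k < n \<and> j < n \<and> A i k \<and> B k j)" using cond by auto
    then have "covers I K J x y z C" by (auto simp: covers_def ikj Let_def)
    then have "grown ?\<rho> C (covers I K J x y z) st" using C st by (auto simp: grown_def)
    then show "run\<^sub>0 Skip st 100 (grown ?\<rho> C (covers I K J x y z))"
      by (intro run_mono[OF run_Skip[of "grown ?\<rho> C (covers I K J x y z)"]]) simp_all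
  qed
  then show ?thesis
    unfolding Let_def by (rule run_mono) (simp_all add: in_block_def A_at_def B_at_def)
qed

lemma run_search_block:
  assumes "sound C" "block_layout I K J C st"
  shows "run\<^sub>0 search_block st (300 * (s * s * s))
    (grown [(''J'', J), (''K'', K), (''I'', I)] C (covers_block I K J))"
proof -
  have "s < M" using size_bounds s by linarith
  \<comment> \<open>The three nested loops have the same range, so one instance serves all. The
    steps outside the iterations are spread over the iterations, of which there is at least
    one.\<close>
  have loop: "run\<^sub>0 (For x vs c) st (s * (T + 14)) (grown \<rho> C (\<lambda>C'. \<forall>i<s. G i C'))"
    if "x \<notin> {''n'', ''s'', ''d''}" "x \<notin> fst ` set \<rho>" "sound C" "layout \<rho> C st"
      "\<And>i C C'. C \<le> C' \<Longrightarrow> G i C \<Longrightarrow> G i C'"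
      "\<And>i C st. i < s \<Longrightarrow> sound C \<Longrightarrow> layout ((x, i) # \<rho>) C st \<Longrightarrow> run\<^sub>0 c st T (grown ((x, i) # \<rho>) C (G i))"
    for x c st T \<rho> C G
  proof (rule run_mono)
    show "run\<^sub>0 (For x vs c) st (s * (T + cost vs + 7) + cost vs + 5) (grown \<rho> C (\<lambda>C'. \<forall>i<s. G i C'))"
      by (rule run_For_grown[OF _ _ _ that(1,2) _ _ that(5,6,3,4)])
        (use \<open>s < M\<close> in \<open>simp_all add: moderate_def layout_def\<close>)
    show "s * (T + cost vs + 7) + cost vs + 5 \<le> s * (T + 14)" using s by (simp add: algebra_simps)
  qed
  have "run\<^sub>0 search_block st (s * (s * (s * (200 + 14) + 14) + 14))
    (grown [(''J'', J), (''K'', K), (''I'', I)] C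
       (\<lambda>C'. \<forall>x<s. \<forall>y<s. \<forall>z<s. covers I K J x y z C'))"
    unfolding search_block_def
  proof (rule loop)
    fix x C st assume 1: "sound C" "layout [(''u'', x), (''J'', J), (''K'', K), (''I'', I)] C st"
    show "run\<^sub>0 (For ''v'' vs (For ''w'' vs
         (let i = in_block ''I'' (Var ''u''); k = in_block ''K'' (Var ''v'');
            j = in_block ''J'' (Var ''w'') in
          If ((i \<^bold>< vn) \<^bold>* (k \<^bold>< vn) \<^bold>* (j \<^bold>< vn) \<^bold>* Mem (A_at i k) \<^bold>* Mem (B_at k j))
            (Store (C_at i j) (Num 1)) Skip))) st (s * (s * (200 + 14) + 14))
        (grown [(''u'', x), (''J'', J), (''K'', K), (''I'', I)] C
          (\<lambda>C'. \<forall>y<s. \<forall>z<s. covers I K J x y z C'))"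
    proof (rule loop[OF _ _ 1])
      fix y C st assume 2: "sound C" "layout [(''v'', y), (''u'', x), (''J'', J), (''K'', K), (''I'', I)] C st"
      show "run\<^sub>0 (For ''w'' vs
         (let i = in_block ''I'' (Var ''u''); k = in_block ''K'' (Var ''v'');
            j = in_block ''J'' (Var ''w'') in
          If ((i \<^bold>< vn) \<^bold>* (k \<^bold>< vn) \<^bold>* (j \<^bold>< vn) \<^bold>* Mem (A_at i k) \<^bold>* Mem (B_at k j))
            (Store (C_at i j) (Num 1)) Skip)) st (s * (200 + 14))
        (grown [(''v'', y), (''u'', x), (''J'', J), (''K'', K), (''I'', I)] C
          (\<lambda>C'. \<forall>z<s. covers I K J x y z C'))"
        by (rule loop[OF _ _ 2 _ run_search_entry]) (auto intro: covers_mono)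
    qed (auto intro: covers_mono)
  qed (use assms in \<open>auto intro: covers_mono\<close>)
  then show ?thesis
  proof (rule run_mono)
    have "s * (s * (s * (200 + 14) + 14) + 14) = 214 * (s * s * s) + 14 * (s * s) + 14 * s"
      by (simp add: algebra_simps)
    moreover have "s * s * 1 \<le> s * s * s" using s by (intro mult_le_mono2) auto
    ultimately show "s * (s * (s * (200 + 14) + 14) + 14) \<le> 300 * (s * s * s)"
      using size_bounds(1) by linarith
  qed (simp add: covers_block_def[abs_def])
qed

end

lemma nth_concat_rows:
  assumes "i < k" "j < n" "\<And>i. length (f i) = n"
  shows "i * n + j < length (concat (map f [0..<k]))"
    and "concat (map f [0..<k]) ! (i * n + j) = f i ! j"
proof -
  have len: "length (concat (map f [0..<k])) = k * n" for k
    using assms(3) by (induction k) auto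
  have "i * n + j < Suc i * n" using assms(2) by simp
  also have "\<dots> \<le> k * n" using assms(1) by (intro mult_le_mono1) simp
  finally show "i * n + j < length (concat (map f [0..<k]))" by (simp add: len)
  show "concat (map f [0..<k]) ! (i * n + j) = f i ! j"
    using assms(1)
  proof (induction k)
    case (Suc k)
    show ?case
    proof (cases "i = k")
      case True
      then show ?thesis by (simp add: nth_append len)
    next
      case False
      then have "i < k" using Suc.prems by simp
      have "i * n + j < Suc i * n" using assms(2) by simp
      also have "\<dots> \<le> k * n" using \<open>i < k\<close> by (intro mult_le_mono1) simp
      finally show ?thesis using Suc.IH[OF \<open>i < k\<close>] by (simp add: nth_append len)
    qed
  qed simp
qed

context search_setting
begin

text \<open>The potential that pays for the exhaustive searches, with \<open>S\<close> the cost of one of them.\<close>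

definition unfilled :: "nat \<Rightarrow> state \<Rightarrow> nat" where
  "unfilled S st = S * card {(i, j). i < n \<and> j < n \<and> snd st (1 + 2 * n * n + i * n + j) = 0}"

lemma unfilled_register: "unfilled S (r(x := a), m) = unfilled S (r, m)"
  by (simp add: unfilled_def)

text \<open>A potential must be a function of the state, so \<open>unfilled\<close> reads memory;
  this lemma translates it back to the matrix \<open>C\<close> of the invariants.\<close>

lemma unfilled_layout:
  assumes "layout \<rho> C st"
  shows "unfilled S st = S * card {(i, j). i < n \<and> j < n \<and> \<not> C i j}"
proof -
  have "{(i, j). i < n \<and> j < n \<and> snd st (1 + 2 * n * n + i * n + j) = 0} =
      {(i, j). i < n \<and> j < n \<and> \<not> C i j}"
    using assms by (auto simp: layout_def matrices_def)
  then show ?thesis by (simp add: unfilled_def)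
qed

lemma finite_unfilled: "finite {(i, j). i < n \<and> j < n \<and> Q i j}"
  by (rule finite_subset[of _ "{..<n} \<times> {..<n}"]) auto

lemma unfilled_le: "unfilled S st \<le> S * (n * n)"
proof -
  have "card {(i, j). i < n \<and> j < n \<and> snd st (1 + 2 * n * n + i * n + j) = 0} \<le>
      card ({..<n} \<times> {..<n})"
    by (intro card_mono) auto
  then show ?thesis unfolding unfilled_def by (intro mult_le_mono2) (simp add: card_cartesian_product)
qed

lemma unfilled_decrease:
  assumes "layout \<rho> C st" "layout \<rho>' C' st'" "C \<le> C'" "i < n" "j < n" "\<not> C i j" "C' i j"
  shows "S + unfilled S st' \<le> unfilled S st"
proof -
  have "{(i, j). i < n \<and> j < n \<and> \<not> C' i j} \<subset> {(i, j). i < n \<and> j < n \<and> \<not> C i j}"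
    using assms(3-7) by (auto simp: le_fun_def)
  then have "card {(i, j). i < n \<and> j < n \<and> \<not> C' i j} < card {(i, j). i < n \<and> j < n \<and> \<not> C i j}"
    using finite_unfilled by (intro psubset_card_mono)
  then have "S * Suc (card {(i, j). i < n \<and> j < n \<and> \<not> C' i j}) \<le>
      S * card {(i, j). i < n \<and> j < n \<and> \<not> C i j}" by (intro mult_le_mono2) simp
  then show ?thesis
    unfolding unfilled_layout[OF assms(1)] unfilled_layout[OF assms(2)] by simp
qed

end

text \<open>The interface through which the subroutine enters. Which of the three problems it solves
  is abstracted away, apart from the node words in front of the input, and only gadgets of the one
  size \<open>s\<close> are asked about.\<close>

locale solver = search_setting +
  fixes Prog :: com and with_nodes :: bool and T\<^sub>P :: nat
  assumes solver: "\<exists>t s'. exec W Prog (initial_state ((if with_nodes then [4 * s, 4 * s + 1] else []) @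
        adjacency_words (gadget_adjacency s P Q R) @ rpq_words (gadget_query s))) t s' \<and>
      t \<le> T\<^sub>P \<and> snd s' 0 < M \<and>
      (snd s' 0 \<noteq> 0 \<longleftrightarrow> (\<exists>x<s. \<exists>y<s. \<exists>z<s. P x y \<and> Q y z \<and> R z x))"
    and fourth_root: "(s * s) * (s * s) \<le> n" "n < ((s + 1) * (s + 1)) * ((s + 1) * (s + 1))"
begin

abbreviation "start \<equiv> vd \<^bold>+ Num (if with_nodes then 0 else 2)"

abbreviation "fill \<equiv> unfilled (300 * (s * s * s))"

text \<open>Commands that keep the cells below \<open>d\<close> cannot change \<open>C\<close>, so
  the potential stays put and their cost is charged in full.\<close>

lemma run_fill:
  assumes "run\<^sub>0 c st T (\<lambda>st'. frame st st' \<and> Q st')" "block_layout I K J C st"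
  shows "run fill c st T (\<lambda>st'. frame st st' \<and> Q st')"
proof (rule run_potential, rule run_mono[OF assms(1)])
  fix st' assume st': "frame st st' \<and> Q st'"
  then have "fill st' = fill st"
    using unfilled_layout[OF assms(2)] unfilled_layout[OF block_layout_frame[OF assms(2)]] by metis
  then show "(frame st st' \<and> Q st') \<and> T + fill st' \<le> T + fill st" using st' by simp
qed simp

text \<open>The cost of the exhaustive search does not show in the bound: it is incurred only after
  a positive answer, and then the potential drops by at least that cost.\<close>

lemma run_block:
  assumes C: "sound C" and st: "block_layout I K J C st"
  shows "run fill (write_db ;; write_query ;; Call Prog start (vp \<^bold>- start) vd (Num 1) ;;
      If (Mem vd) search_block Skip) st (25000 * (s * s) + T\<^sub>P)
    (grown [(''J'', J), (''K'', K), (''I'', I)] C (covers_block I K J))"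
proof -
  let ?\<rho> = "[(''J'', J), (''K'', K), (''I'', I)]"
  let ?P = "in_blocks n s I K A" and ?Q = "in_blocks n s K J B"
    and ?R = "in_blocks n s J I (\<lambda>j i. \<not> C i j)"
  let ?db = "adjacency_words (block_adjacency I K J C)" and ?q = "rpq_words (gadget_query s)"
  let ?xs = "(if with_nodes then [4 * s, 4 * s + 1] else []) @ ?db @ ?q"
  let ?found = "\<exists>x<s. \<exists>y<s. \<exists>z<s. ?P x y \<and> ?Q y z \<and> ?R z x"
  have q: "length ?q = 10 * s + 9" by (simp add: length_rpq_words rpq_length_gadget_query)
  obtain t sP where sP: "exec W Prog (initial_state ?xs) t sP" "t \<le> T\<^sub>P" "snd sP 0 < M"
      "snd sP 0 \<noteq> 0 \<longleftrightarrow> ?found"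
    using solver[of ?P ?Q ?R] by (elim exE conjE) (rule that)
  let ?D = "\<lambda>st'. words (snd st') d (4 * s # (4 * s + 1) # ?db) \<and>
      fst st' ''p'' = d + 2 + length ?db \<and> fst st' ''p'' \<le> d + 200 * (s * s)"
  let ?E = "\<lambda>st'. words (snd st') d ((4 * s # (4 * s + 1) # ?db) @ ?q) \<and>
      fst st' ''p'' = d + 2 + length ?db + length ?q \<and> fst st' ''p'' \<le> d + 300 * (s * s)"
  have db: "run fill write_db st (20000 * (s * s)) (\<lambda>st'. frame st st' \<and> ?D st')"
    by (rule run_fill[OF run_write_db[OF st] st])
  have query: "run fill write_query st1 (500 * s) (\<lambda>st'. frame st1 st' \<and> ?E st')"
    if st1: "frame st st1" "?D st1" for st1
  proof (rule run_fill[OF _ block_layout_frame[OF st st1(1)]], rule run_mono[OF run_write_query])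
    show "d \<le> fst st1 ''p''" "fst st1 ''p'' + 30 * s < M" using st1 size_bounds by linarith+
    show "fst st1 ''s'' = s" using st st1 by (simp add: frame_def layout_def)
  next
    fix st' assume st': "appended st1 ?q st'"
    have p: "fst st1 ''p'' = d + length (4 * s # (4 * s + 1) # ?db)" using st1 by simp
    have "words (snd st') d (4 * s # (4 * s + 1) # ?db)"
    proof (rule words_cong)
      show "words (snd st1) d (4 * s # (4 * s + 1) # ?db)" using st1 by blast
    next
      fix b assume "b < d + length (4 * s # (4 * s + 1) # ?db)"
      then have "b < fst st1 ''p''" unfolding p .
      then show "snd st' b = snd st1 b" using st' by (simp add: appended_def)
    qed
    moreover have "words (snd st') (d + length (4 * s # (4 * s + 1) # ?db)) ?q"
      using st' p by (simp add: appended_def)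
    ultimately have "words (snd st') d ((4 * s # (4 * s + 1) # ?db) @ ?q)"
      unfolding words_append by blast
    moreover have "fst st' ''p'' = fst st1 ''p'' + length ?q" "frame st1 st'"
      using st' by (auto simp: appended_def)
    moreover from this have "fst st' ''p'' \<le> d + 300 * (s * s)"
      using st1 q size_bounds(1) s by linarith
    ultimately show "frame st1 st' \<and> ?E st'" using st1 by simp
  qed simp
  have call: "run fill (Call Prog start (vp \<^bold>- start) vd (Num 1)) st2 (400 * (s * s) + T\<^sub>P)
      (\<lambda>st'. frame st2 st' \<and> snd st' d = snd sP 0)"
    if st2: "frame st st2" "?E st2" for st2
  proof (rule run_fill[OF _ block_layout_frame[OF st st2(1)]])
    have regs: "fst st2 ''d'' = d" using st st2 by (simp add: frame_def layout_def)
    \<comment> \<open>The two node words are always in memory; without nodes the call starts two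
      cells later.\<close>
    have vals: "val start st2 = d + (if with_nodes then 0 else 2)" "val vd st2 = d"
        "val (vp \<^bold>- start) st2 = length ?xs" "val (Num 1) st2 = 1"
      using regs st2 by auto
    have off: "(if with_nodes then 0 else 2) + length ?xs = 2 + length ?db + length ?q" by simp
    have "run\<^sub>0 (Call Prog start (vp \<^bold>- start) vd (Num 1)) st2
        (1 + cost start + cost (vp \<^bold>- start) + cost vd + cost (Num 1) + length ?xs + 1 + T\<^sub>P)
        (\<lambda>st'. frame st2 st' \<and> snd st' d = snd sP 0)"
    proof (rule run_Call)
      show "words (snd st2) (val start st2) ?xs"
        using st2 unfolding vals by (simp add: words_append words_Cons words_Nil add_ac)
      show "val start st2 + length ?xs \<le> W" "val vd st2 < W"
        using st2 M_le_W size_bounds(5) off unfolding vals by linarith+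
      show "exec W Prog (initial_state ?xs) t sP" "t \<le> T\<^sub>P" "snd sP 0 < M" by fact+
      \<comment> \<open>The answer overwrites the first cell of the input. This is harmless:
        \<open>frame\<close> covers only the cells below \<open>d\<close>, and the input is written
        anew before each call.\<close>
      show "frame st2 (fst st2, (snd st2)(val vd st2 := snd sP 0)) \<and>
          snd (fst st2, (snd st2)(val vd st2 := snd sP 0)) d = snd sP 0"
        unfolding vals frame_def by simp
    qed (use vals in \<open>auto simp: moderate_def\<close>)
    then show "run\<^sub>0 (Call Prog start (vp \<^bold>- start) vd (Num 1)) st2 (400 * (s * s) + T\<^sub>P)
        (\<lambda>st'. frame st2 st' \<and> snd st' d = snd sP 0)"
    proof (rule run_mono)
      have "14 + length ?db + length ?q \<le> 400 * (s * s)" using st2 size_bounds(1) s by linarith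
      then show "1 + cost start + cost (vp \<^bold>- start) + cost vd + cost (Num 1) + length ?xs + 1 + T\<^sub>P
          \<le> 400 * (s * s) + T\<^sub>P"
        by simp
    qed
  qed
  have search: "run fill (If (Mem vd) search_block Skip) st3 4 (grown ?\<rho> C (covers_block I K J))"
    if st3: "frame st st3" "snd st3 d = snd sP 0" for st3
  proof -
    have lay: "block_layout I K J C st3" using block_layout_frame[OF st st3(1)] .
    then have "val (Mem vd) st3 = snd sP 0" using st3 by (simp add: layout_def)
    then have found: "val (Mem vd) st3 \<noteq> 0 \<longleftrightarrow> ?found" using sP(4) by simp
    have "run fill (If (Mem vd) search_block Skip) st3 (1 + cost (Mem vd) + 1)
        (grown ?\<rho> C (covers_block I K J))"
    proof (rule run_If)
      assume "val (Mem vd) st3 \<noteq> 0"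
      then obtain x y z where xyz: "x < s" "y < s" "z < s" "?P x y" "?Q y z" "?R z x"
        using found by blast
      show "run fill search_block st3 1 (grown ?\<rho> C (covers_block I K J))"
      proof (rule run_potential, rule run_mono[OF run_search_block[OF C lay]])
        fix st' assume st': "grown ?\<rho> C (covers_block I K J) st'"
        then obtain C' where C': "C \<le> C'" "layout ?\<rho> C' st'" "covers_block I K J C'"
          by (auto simp: grown_def)
        then have "covers I K J x y z C'" using xyz by (simp add: covers_block_def)
        \<comment> \<open>The triangle behind the answer yields the entry at row
          \<open>I * s + x\<close> and column \<open>J * s + z\<close>, unset before the search and
          set after it.\<close>
        then have "300 * (s * s * s) + fill st' \<le> fill st3"
          using xyz by (intro unfilled_decrease[OF lay C'(2,1), of "I * s + x" "J * s + z"])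
            (auto simp: covers_def in_blocks_def Let_def)
        then show "grown ?\<rho> C (covers_block I K J) st' \<and> 300 * (s * s * s) + fill st' \<le> 1 + fill st3"
          using st' by simp
      qed simp
    next
      assume "val (Mem vd) st3 = 0"
      then have "\<not> ?found" using found by simp
      \<comment> \<open>Without a triangle, every entry of the product witnessed in these blocks is
        already set, so skipping the search loses nothing.\<close>
      have "covers I K J x y z C" if "x < s" "y < s" "z < s" for x y z
      proof (rule ccontr)
        assume "\<not> covers I K J x y z C"
        then have "?P x y" "?Q y z" "?R z x" by (simp_all add: covers_def in_blocks_def Let_def)
        with that \<open>\<not> ?found\<close> show False by blast
      qed
      then have "covers_block I K J C" by (simp add: covers_block_def)
      then have "grown ?\<rho> C (covers_block I K J) st3" using C lay by (auto simp: grown_def)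
      then show "run fill Skip st3 1 (grown ?\<rho> C (covers_block I K J))"
        by (intro run_potential[OF run_Skip]) simp
    qed (simp add: moderate_def)
    then show ?thesis by (rule run_mono) simp_all
  qed
  have after_query: "run fill (Call Prog start (vp \<^bold>- start) vd (Num 1) ;; If (Mem vd) search_block Skip)
      st2 ((400 * (s * s) + T\<^sub>P) + 4) (grown ?\<rho> C (covers_block I K J))"
    if "frame st st2" "?E st2" for st2
    by (rule run_Seq, rule run_mono[OF call[OF that] le_refl], erule conjE,
        rule search[OF frame_trans[OF that(1)]])
  have after_db: "run fill (write_query ;; Call Prog start (vp \<^bold>- start) vd (Num 1) ;;
      If (Mem vd) search_block Skip) st1 (500 * s + ((400 * (s * s) + T\<^sub>P) + 4))
      (grown ?\<rho> C (covers_block I K J))"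
    if "frame st st1" "?D st1" for st1
    by (rule run_Seq, rule run_mono[OF query[OF that] le_refl], erule conjE,
        rule after_query[OF frame_trans[OF that(1)]])
  have "run fill (write_db ;; write_query ;; Call Prog start (vp \<^bold>- start) vd (Num 1) ;;
      If (Mem vd) search_block Skip) st (20000 * (s * s) + (500 * s + ((400 * (s * s) + T\<^sub>P) + 4)))
    (grown ?\<rho> C (covers_block I K J))"
    by (rule run_Seq, rule run_mono[OF db le_refl], erule conjE, rule after_db)
  then show ?thesis by (rule run_mono) (use size_bounds(1) s in linarith)
qed

section \<open>The complete program\<close>

lemma run_Assign_fill:
  assumes "moderate e" "val e st < M" "Q ((fst st)(x := val e st), snd st)"
  shows "run fill (x ::= e) st (1 + cost e) Q"
  by (rule run_potential, rule run_Assign) (use assms unfilled_register[of _ "fst st"] in simp_all)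

lemma d_eq: "d = 1 + 3 * (n * n)"
  by (simp add: d)

lemma root_unique:
  assumes "1 \<le> k" "k \<le> s" "n < ((k + 1) * (k + 1)) * ((k + 1) * (k + 1))"
  shows "k = s"
proof (rule ccontr)
  assume "k \<noteq> s"
  then have "k + 1 \<le> s" using assms by simp
  then have "((k + 1) * (k + 1)) * ((k + 1) * (k + 1)) \<le> (s * s) * (s * s)"
    by (intro mult_le_mono)
  then show False using assms(3) fourth_root(1) by linarith
qed

lemma less_root:
  assumes "((k + 1) * (k + 1)) * ((k + 1) * (k + 1)) \<le> n"
  shows "k + 1 \<le> s"
proof (rule ccontr)
  assume "\<not> k + 1 \<le> s"
  then have "((s + 1) * (s + 1)) * ((s + 1) * (s + 1)) \<le> ((k + 1) * (k + 1)) * ((k + 1) * (k + 1))"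
    by (intro mult_le_mono) auto
  then show False using assms fourth_root(2) by linarith
qed

text \<open>Counting upwards takes time linear in \<open>s\<close>, far below the remaining work.
  \<open>less_root\<close> keeps the counter from overshooting and \<open>root_unique\<close> from
  stopping early.\<close>

lemma run_find_root:
  assumes "fst st ''n'' = n" "fst st ''s'' = 1"
  shows "run fill (While (((vs \<^bold>+ Num 1) \<^bold>* (vs \<^bold>+ Num 1)) \<^bold>* ((vs \<^bold>+ Num 1) \<^bold>* (vs \<^bold>+ Num 1))
      \<^bold>< vn \<^bold>+ Num 1) (''s'' ::= vs \<^bold>+ Num 1)) st (50 * s)
    (\<lambda>st'. fst st' ''n'' = n \<and> fst st' ''s'' = s \<and> snd st' = snd st)" (is "run fill (While ?e ?c) st _ _")
proof -
  let ?Inv = "\<lambda>st'. fst st' ''n'' = n \<and> 1 \<le> fst st' ''s'' \<and> fst st' ''s'' \<le> s \<and> snd st' = snd st"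
  have cond: "val ?e st' \<noteq> 0 \<longleftrightarrow> ((fst st' ''s'' + 1) * (fst st' ''s'' + 1)) *
      ((fst st' ''s'' + 1) * (fst st' ''s'' + 1)) \<le> n" if "fst st' ''n'' = n" for st'
  proof -
    have "of_bool (x < n + 1) \<noteq> (0::nat) \<longleftrightarrow> x \<le> n" for x by auto
    then show ?thesis by (simp only: val.simps apply_bop.simps that)
  qed
  have "s < M" using size_bounds s by linarith
  have "run fill (While ?e ?c) st ((s - fst st ''s'') * (1 + cost ?e + 4) + (1 + cost ?e))
      (\<lambda>st'. fst st' ''n'' = n \<and> fst st' ''s'' = s \<and> snd st' = snd st)"
  proof (rule run_While[where Inv = ?Inv and f = "\<lambda>st'. s - fst st' ''s''"])
    fix st' assume st': "?Inv st'" "val ?e st' \<noteq> 0"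
    then have "((fst st' ''s'' + 1) * (fst st' ''s'' + 1)) *
      ((fst st' ''s'' + 1) * (fst st' ''s'' + 1)) \<le> n" using cond by blast
    then have "fst st' ''s'' + 1 \<le> s" by (rule less_root)
    then have "run fill ?c st' (1 + cost (vs \<^bold>+ Num 1)) (\<lambda>s'. ?Inv s' \<and> s - fst s' ''s'' < s - fst st' ''s'')"
      using st' \<open>s < M\<close> by (intro run_Assign_fill) (auto simp: moderate_def)
    then show "run fill ?c st' 4 (\<lambda>s'. ?Inv s' \<and> s - fst s' ''s'' < s - fst st' ''s'')"
      by (rule run_mono) simp_all
  next
    fix st' assume st': "?Inv st'" "val ?e st' = 0"
    then have "n < ((fst st' ''s'' + 1) * (fst st' ''s'' + 1)) *
      ((fst st' ''s'' + 1) * (fst st' ''s'' + 1))" using cond[of st'] by linarith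
    then have "fst st' ''s'' = s" using st'(1) by (intro root_unique) auto
    then show "fst st' ''n'' = n \<and> fst st' ''s'' = s \<and> snd st' = snd st" using st' by simp
  qed (use assms s in \<open>simp_all add: moderate_def\<close>)
  then show ?thesis
  proof (rule run_mono)
    have "(s - fst st ''s'') * 24 \<le> s * 24 - 24" using assms by simp
    then show "(s - fst st ''s'') * (1 + cost ?e + 4) + (1 + cost ?e) \<le> 50 * s" using s by simp
  qed
qed

text \<open>All indices below \<open>n\<close> lie in the first \<open>n div s + 1\<close> blocks;
  if \<open>s\<close> divides \<open>n\<close>, the last block is empty, at the price of a constant
  factor.\<close>

lemma run_blocks:
  assumes "sound C" "layout [] C st"
  defines "b \<equiv> n div s + 1" and "e \<equiv> Op Div vn vs \<^bold>+ Num 1"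
  shows "run fill (For ''I'' e (For ''K'' e (For ''J'' e
      (write_db ;; write_query ;; Call Prog start (vp \<^bold>- start) vd (Num 1) ;;
       If (Mem vd) search_block Skip)))) st (b * b * b * (25100 * (s * s) + T\<^sub>P))
    (grown [] C (\<lambda>C'. \<forall>I<b. \<forall>K<b. \<forall>J<b. covers_block I K J C'))"
proof -
  let ?body = "write_db ;; write_query ;; Call Prog start (vp \<^bold>- start) vd (Num 1) ;;
       If (Mem vd) search_block Skip"
  have "n div s \<le> n" by simp
  then have b: "b < M" "1 \<le> b" using size_bounds d_eq unfolding b_def by linarith+
  have loop: "run fill (For x e c) st (b * (T + 22)) (grown \<rho> C (\<lambda>C'. \<forall>i<b. G i C'))"
    if "x \<notin> {''n'', ''s'', ''d''}" "x \<notin> fst ` set \<rho>" "sound C" "layout \<rho> C st"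
      "\<And>i C C'. C \<le> C' \<Longrightarrow> G i C \<Longrightarrow> G i C'"
      "\<And>i C st. i < b \<Longrightarrow> sound C \<Longrightarrow> layout ((x, i) # \<rho>) C st \<Longrightarrow>
        run fill c st T (grown ((x, i) # \<rho>) C (G i))"
    for x c st T \<rho> C G
  proof (rule run_mono)
    show "run fill (For x e c) st (b * (T + cost e + 7) + cost e + 5) (grown \<rho> C (\<lambda>C'. \<forall>i<b. G i C'))"
      by (rule run_For_grown[OF _ _ _ that(1,2) _ _ that(5,6,3,4)])
        (use b in \<open>simp_all add: moderate_def layout_def unfilled_register e_def b_def\<close>)
    show "b * (T + cost e + 7) + cost e + 5 \<le> b * (T + 22)" using b by (simp add: e_def algebra_simps)
  qed
  let ?T = "25000 * (s * s) + T\<^sub>P"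
  have "run fill (For ''I'' e (For ''K'' e (For ''J'' e ?body))) st
      (b * (b * (b * (?T + 22) + 22) + 22))
      (grown [] C (\<lambda>C'. \<forall>I<b. \<forall>K<b. \<forall>J<b. covers_block I K J C'))"
  proof (rule loop)
    fix I C st assume 1: "sound C" "layout [(''I'', I)] C st"
    show "run fill (For ''K'' e (For ''J'' e ?body)) st (b * (b * (?T + 22) + 22))
        (grown [(''I'', I)] C (\<lambda>C'. \<forall>K<b. \<forall>J<b. covers_block I K J C'))"
    proof (rule loop[OF _ _ 1])
      fix K C st assume 2: "sound C" "layout [(''K'', K), (''I'', I)] C st"
      show "run fill (For ''J'' e ?body) st (b * (?T + 22))
          (grown [(''K'', K), (''I'', I)] C (\<lambda>C'. \<forall>J<b. covers_block I K J C'))"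
        by (rule loop[OF _ _ 2 _ run_block]) (auto intro: covers_block_mono)
    qed (auto intro: covers_block_mono)
  qed (use assms(1,2) in \<open>auto intro: covers_block_mono\<close>)
  then show ?thesis
  proof (rule run_mono)
    have "b * 1 \<le> b * b" "b * b * 1 \<le> b * b * b" using b by (auto intro: mult_le_mono)
    then have "b * b * b * 22 + b * b * 22 + b * 22 \<le> b * b * b * 66" by linarith
    also have "\<dots> \<le> b * b * b * (100 * (s * s))"
      using size_bounds(1) s by (intro mult_le_mono2) linarith
    finally have "b * b * b * ?T + (b * b * b * 22 + b * b * 22 + b * 22) \<le>
        b * b * b * ?T + b * b * b * (100 * (s * s))"
      by (rule add_left_mono)
    then show "b * (b * (b * (?T + 22) + 22) + 22) \<le> b * b * b * (25100 * (s * s) + T\<^sub>P)"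
      by (simp add: algebra_simps)
  qed
qed

text \<open>The output must start at address 0. The copy overwrites \<open>n\<close> and entries of
  \<open>A\<close>, but its targets lie below \<open>n * n\<close> and hence below the cells of
  \<open>C\<close>, so no source is destroyed and the potential is unchanged. The loop limit comes
  from the register, not from memory.\<close>

lemma run_copy_product:
  assumes "layout [] C st"
  shows "run fill (For ''u'' (vn \<^bold>* vn) (Store (Var ''u'') (Mem (C_at (Num 0) (Var ''u''))))) st
    (100 * (n * n)) (\<lambda>st'. \<forall>i<n. \<forall>j<n. snd st' (i * n + j) = of_bool (C i j))"
proof (rule run_potential)
  let ?off = "1 + 2 * n * n"
  let ?Inv = "\<lambda>k st'. fst st' ''n'' = n \<and> (\<forall>a<k. snd st' a = snd st (?off + a)) \<and>
      (\<forall>a\<ge>?off. snd st' a = snd st a)"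
  have n: "fst st ''n'' = n" and mat: "matrices n A B C (snd st)" using assms by (auto simp: layout_def)
  have entry: "snd st (?off + (i * n + j)) = of_bool (C i j)" if "i < n" "j < n" for i j
    using mat that unfolding matrices_def by (simp add: add.assoc)
  have small: "snd st (?off + a) < M" if a: "a < n * n" for a
  proof -
    have "a div n < n" "a mod n < n" using a size_bounds(4) by (auto simp: less_mult_imp_div_less)
    from entry[OF this] have "snd st (?off + a) = of_bool (C (a div n) (a mod n))" by simp
    also have "\<dots> < M" using ten_le_M by simp
    finally show ?thesis .
  qed
  have "run\<^sub>0 (For ''u'' (vn \<^bold>* vn) (Store (Var ''u'') (Mem (C_at (Num 0) (Var ''u''))))) st
      (n * n * (30 + cost (vn \<^bold>* vn) + 7) + cost (vn \<^bold>* vn) + 5) (?Inv (n * n))"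
  proof (rule run_For[where Inv = ?Inv])
    show "n * n < M" using size_bounds(5) d_eq by linarith
  next
    fix k st' assume st': "?Inv k st'" "k < n * n" "fst st' ''u'' = k"
    have v: "val (Mem (C_at (Num 0) (Var ''u''))) st' = snd st (?off + k)"
        "val (Var ''u'') st' = k"
      using st' by (simp_all add: C_at_def)
    have "run\<^sub>0 (Store (Var ''u'') (Mem (C_at (Num 0) (Var ''u'')))) st'
      (1 + cost (Var ''u'') + cost (Mem (C_at (Num 0) (Var ''u''))))
      (\<lambda>s'. fst s' ''u'' = k \<and> ?Inv (Suc k) ((fst s')(''u'' := Suc k), snd s'))"
    proof (rule run_Store)
      show "val (Mem (C_at (Num 0) (Var ''u''))) st' < M" unfolding v by (rule small[OF st'(2)])
      show "fst (fst st', (snd st')(val (Var ''u'') st' := val (Mem (C_at (Num 0) (Var ''u''))) st')) ''u'' = k \<and>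
        ?Inv (Suc k) ((fst (fst st', (snd st')(val (Var ''u'') st' := val (Mem (C_at (Num 0) (Var ''u''))) st')))
            (''u'' := Suc k), snd (fst st', (snd st')(val (Var ''u'') st' := val (Mem (C_at (Num 0) (Var ''u''))) st')))"
        unfolding v using st' by (auto simp: less_Suc_eq)
    qed (simp_all add: moderate_def C_at_def)
    then show "run\<^sub>0 (Store (Var ''u'') (Mem (C_at (Num 0) (Var ''u'')))) st' 30
      (\<lambda>s'. fst s' ''u'' = k \<and> ?Inv (Suc k) ((fst s')(''u'' := Suc k), snd s'))"
      by (rule run_mono) (simp_all add: C_at_def)
  qed (use n in \<open>auto simp: moderate_def\<close>)
  then show "run\<^sub>0 (For ''u'' (vn \<^bold>* vn) (Store (Var ''u'') (Mem (C_at (Num 0) (Var ''u''))))) st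
    (100 * (n * n)) (\<lambda>st'. (\<forall>i<n. \<forall>j<n. snd st' (i * n + j) = of_bool (C i j)) \<and>
      100 * (n * n) + fill st' \<le> 100 * (n * n) + fill st)"
  proof (rule run_mono)
    show "n * n * (30 + cost (vn \<^bold>* vn) + 7) + cost (vn \<^bold>* vn) + 5 \<le> 100 * (n * n)"
    proof -
      have "2 \<le> 15 * (n * n)" using size_bounds(3,4) by linarith
      then show ?thesis by simp
    qed
  next
    fix st' assume "?Inv (n * n) st'"
    then show "(\<forall>i<n. \<forall>j<n. snd st' (i * n + j) = of_bool (C i j)) \<and>
      100 * (n * n) + fill st' \<le> 100 * (n * n) + fill st"
      using entry row_major_less by (simp add: unfilled_def)
  qed
qed

lemma run_block_search:
  assumes regs: "fst st = (\<lambda>_. 0)" and mem: "snd st 0 = n" "matrices n A B (\<lambda>_ _. False) (snd st)"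
  defines "b \<equiv> n div s + 1"
  shows "run fill (block_search with_nodes Prog) st
    (b * b * b * (25100 * (s * s) + T\<^sub>P) + 200 * (n * n))
    (\<lambda>st'. \<forall>i<n. \<forall>j<n. snd st' (i * n + j) = of_bool (\<exists>k<n. A i k \<and> B k j))"
proof -
  let ?C\<^sub>0 = "\<lambda>_ _. False"
  let ?Q = "\<lambda>st'. \<forall>i<n. \<forall>j<n. snd st' (i * n + j) = of_bool (\<exists>k<n. A i k \<and> B k j)"
  let ?d = "Num 1 \<^bold>+ Num 3 \<^bold>* vn \<^bold>* vn"
  have small: "n < M" "1 < M" "d < M" using size_bounds d_eq ten_le_M by linarith+
  have sound: "sound ?C\<^sub>0" by (simp add: sound_def)
  have product: "run fill (For ''u'' (vn \<^bold>* vn) (Store (Var ''u'') (Mem (C_at (Num 0) (Var ''u''))))) st'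
      (100 * (n * n)) ?Q"
    if "grown [] ?C\<^sub>0 (\<lambda>C'. \<forall>I<b. \<forall>K<b. \<forall>J<b. covers_block I K J C') st'" for st'
  proof -
    from that obtain C where C: "sound C" "layout [] C st'"
        "\<forall>I<b. \<forall>K<b. \<forall>J<b. covers_block I K J C"
      by (auto simp: grown_def)
    have block: "i div s < b" "i mod s < s" if "i < n" for i
      using that s div_le_mono[of i n s] by (simp_all add: b_def less_Suc_eq_le)
    have "C i j \<longleftrightarrow> (\<exists>k<n. A i k \<and> B k j)" if ij: "i < n" "j < n" for i j
    proof
      assume "C i j"
      then show "\<exists>k<n. A i k \<and> B k j" using C(1) ij by (simp add: sound_def)
    next
      assume "\<exists>k<n. A i k \<and> B k j"
      then obtain k where k: "k < n" "A i k" "B k j" by blast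
      have "covers (i div s) (k div s) (j div s) (i mod s) (k mod s) (j mod s) C"
        using C(3) block[OF ij(1)] block[OF ij(2)] block[OF k(1)] by (simp add: covers_block_def)
      then show "C i j" using ij k by (simp add: covers_def Let_def)
    qed
    then show ?thesis by (intro run_mono[OF run_copy_product[OF C(2)]]) simp_all
  qed
  have "run fill (block_search with_nodes Prog) st
    ((1 + cost (Mem (Num 0))) + ((1 + cost (Num 1)) + (50 * s + ((1 + cost ?d) +
      (b * b * b * (25100 * (s * s) + T\<^sub>P) + (100 * (n * n))))))) ?Q"
    unfolding block_search_def Let_def
  proof (rule run_Seq, rule run_Assign_fill, simp add: moderate_def, simp add: mem small,
      rule run_Seq, rule run_Assign_fill, simp add: moderate_def, simp add: small[simplified],
      rule run_Seq, rule run_mono[OF run_find_root])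
    fix st' assume st': "fst st' ''n'' = n \<and> fst st' ''s'' = s \<and> snd st' =
      snd ((fst ((fst st)(''n'' := val (Mem (Num 0)) st), snd st))
        (''s'' := val (Num 1) ((fst st)(''n'' := val (Mem (Num 0)) st), snd st)),
        snd ((fst st)(''n'' := val (Mem (Num 0)) st), snd st))"
    have d_val: "val ?d st' = d" using st' by (simp add: d)
    have "layout [] ?C\<^sub>0 ((fst st')(''d'' := val ?d st'), snd st')"
      unfolding d_val using st' mem by (simp add: layout_def)
    note blocks = run_blocks[OF sound this, folded b_def]
    show "run fill (''d'' ::= ?d ;;
       For ''I'' (Op Div vn vs \<^bold>+ Num 1) (For ''K'' (Op Div vn vs \<^bold>+ Num 1) (For ''J'' (Op Div vn vs \<^bold>+ Num 1)
      (write_db ;; write_query ;; Call Prog start (vp \<^bold>- start) vd (Num 1) ;;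
       If (Mem vd) search_block Skip))) ;;
       For ''u'' (vn \<^bold>* vn) (Store (Var ''u'') (Mem (C_at (Num 0) (Var ''u''))))) st'
       ((1 + cost ?d) + (b * b * b * (25100 * (s * s) + T\<^sub>P) +
         (100 * (n * n)))) ?Q"
      by (rule run_Seq, rule run_Assign_fill, simp add: moderate_def, unfold d_val, rule small(3),
          fold d_val, rule run_Seq, rule run_mono[OF blocks le_refl], rule product)
  qed (simp_all add: mem)
  then show ?thesis
  proof (rule run_mono)
    show "(1 + cost (Mem (Num 0))) + ((1 + cost (Num 1)) + (50 * s + ((1 + cost ?d) +
      (b * b * b * (25100 * (s * s) + T\<^sub>P) + (100 * (n * n))))))
      \<le> b * b * b * (25100 * (s * s) + T\<^sub>P) + 200 * (n * n)"
    proof -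
      have "13 + 50 * s \<le> 100 * (n * n)" using size_bounds s by linarith
      then show ?thesis by simp
    qed
  qed
qed

end

section \<open>The running time\<close>

text \<open>The number of blocks is at most 2 n / s, so the calls cost a constant times n^3 /
  s^\<delta>, and n < (2 s)^4 bounds 1 / s^\<delta> by 2 / n^(\<delta>/4). The searches cost 300 s^3
  n^2, at most 300 n^(11/4) by s^4 \<le> n.\<close>

lemma block_search_time:
  fixes n s c T\<^sub>P :: nat and \<delta> \<epsilon> :: real
  assumes s: "1 \<le> s" and root: "(s * s) * (s * s) \<le> n"
      "n < ((s + 1) * (s + 1)) * ((s + 1) * (s + 1))"
    and \<delta>: "0 < \<delta>" "\<delta> \<le> 1" "\<delta> \<le> \<epsilon>"
    and T\<^sub>P: "real T\<^sub>P \<le> real c * (real (4 * s + 2) powr (3 - \<epsilon>) + real (10 * s + 9) powr (3 - \<epsilon>))"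
  defines "b \<equiv> n div s + 1"
  shows "real (b * b * b * (25100 * (s * s) + T\<^sub>P) + 200 * (n * n) + 300 * (s * s * s) * (n * n)) \<le>
    real (16 * (25100 + 13718 * c) + 500) * real n powr (3 - \<delta> / 4)"
proof -
  define x y where xy: "x = real s" "y = real n"
  have "s \<le> n" using root(1) le_square[of s] le_square[of "s * s"] by linarith
  then have x: "1 \<le> x" "x \<le> y" "1 \<le> y" using s by (auto simp: xy)
  define K where "K = 25100 + 13718 * real c"
  \<comment> \<open>Both \<open>4 * s + 2\<close> and \<open>10 * s + 9\<close> are at most
    \<open>19 * s\<close>, and 19^3 = 6859; the two summands together give 13718.\<close>
  have powr_bound: "real k powr (3 - \<epsilon>) \<le> 6859 * x powr (3 - \<delta>)" if "1 \<le> k" "k \<le> 19 * s" for k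
  proof -
    have "real k powr (3 - \<epsilon>) \<le> real k powr (3 - \<delta>)" using that \<delta> by (intro powr_mono) auto
    also have "\<dots> \<le> (19 * x) powr (3 - \<delta>)"
      using that(2) \<delta> of_nat_mono[OF that(2), where 'a = real] by (intro powr_mono2) (auto simp: xy)
    also have "\<dots> = 19 powr (3 - \<delta>) * x powr (3 - \<delta>)" using x by (simp add: powr_mult)
    also have "\<dots> \<le> 19 powr 3 * x powr (3 - \<delta>)" using \<delta> by (intro mult_right_mono powr_mono) auto
    finally show ?thesis by simp
  qed
  have "real T\<^sub>P \<le> real c * (6859 * x powr (3 - \<delta>) + 6859 * x powr (3 - \<delta>))"
    using s by (intro order_trans[OF T\<^sub>P] mult_left_mono add_mono powr_bound) auto
  \<comment> \<open>The quadratic time for writing the input disappears in s^(3 - \<delta>) because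
    \<delta> \<le> 1.\<close>
  moreover have "x * x \<le> x powr (3 - \<delta>)"
  proof -
    have "x * x = x powr 2" using x by (simp add: powr_numeral power2_eq_square)
    also have "\<dots> \<le> x powr (3 - \<delta>)" using x \<delta> by (intro powr_mono) auto
    finally show ?thesis .
  qed
  ultimately have inner: "25100 * (x * x) + real T\<^sub>P \<le> K * x powr (3 - \<delta>)"
    by (simp add: K_def algebra_simps)
  have b: "real b \<le> 2 * (y / x)"
  proof -
    have "real (n div s) \<le> y / x" unfolding xy by (rule of_nat_div_le_of_nat)
    moreover have "1 \<le> y / x" using x by simp
    ultimately show ?thesis by (simp add: b_def)
  qed
  have "real b * real b * real b \<le> (2 * (y / x)) * (2 * (y / x)) * (2 * (y / x))"
    using b x by (intro mult_mono) auto
  also have "\<dots> = 8 * (y powr 3 / x powr 3)"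
    using x by (simp add: powr_numeral power3_eq_cube)
  finally have b3: "real b * real b * real b \<le> 8 * (y powr 3 / x powr 3)" .
  have root_le: "y powr (\<delta> / 4) \<le> 2 * x powr \<delta>"
  proof -
    have "n \<le> ((2 * s) * (2 * s)) * ((2 * s) * (2 * s))"
      using root(2) mult_le_mono[OF mult_le_mono[of "s + 1" "2 * s" "s + 1" "2 * s"]
        mult_le_mono[of "s + 1" "2 * s" "s + 1" "2 * s"]] s by linarith
    then have "y \<le> real (((2 * s) * (2 * s)) * ((2 * s) * (2 * s)))"
      unfolding xy by (rule of_nat_mono)
    also have "\<dots> = (2 * x) powr 4" using x by (simp add: xy powr_numeral power4_eq_xxxx)
    finally have "y powr (\<delta> / 4) \<le> ((2 * x) powr 4) powr (\<delta> / 4)"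
      using x \<delta> by (intro powr_mono2) auto
    also have "\<dots> = 2 powr \<delta> * x powr \<delta>"
      unfolding powr_powr using x by (simp add: powr_mult)
    also have "\<dots> \<le> 2 powr 1 * x powr \<delta>" using \<delta> by (intro mult_right_mono powr_mono) auto
    finally show ?thesis by simp
  qed
  have "real (b * b * b * (25100 * (s * s) + T\<^sub>P)) = (real b * real b * real b) * (25100 * (x * x) + real T\<^sub>P)"
    by (simp add: xy)
  also have "\<dots> \<le> (8 * (y powr 3 / x powr 3)) * (K * x powr (3 - \<delta>))"
    by (rule mult_mono[OF b3 inner]) (use x in auto)
  also have "\<dots> = 8 * K * (y powr 3 / x powr \<delta>)" using x by (simp add: powr_diff field_simps)
  also have "\<dots> \<le> 8 * K * (2 * y powr (3 - \<delta> / 4))"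
  proof (intro mult_left_mono)
    have "y powr 3 = y powr (3 - \<delta> / 4) * y powr (\<delta> / 4)" by (simp add: powr_add[symmetric])
    also have "\<dots> \<le> y powr (3 - \<delta> / 4) * (2 * x powr \<delta>)" using root_le by (intro mult_left_mono) auto
    finally show "y powr 3 / x powr \<delta> \<le> 2 * y powr (3 - \<delta> / 4)"
      using x by (simp add: divide_le_eq algebra_simps)
  qed (simp add: K_def)
  finally have main: "real (b * b * b * (25100 * (s * s) + T\<^sub>P)) \<le> 16 * K * y powr (3 - \<delta> / 4)"
    by simp
  have y2: "y * y \<le> y powr (3 - \<delta> / 4)"
  proof -
    have "y * y = y powr 2" using x by (simp add: powr_numeral power2_eq_square)
    also have "\<dots> \<le> y powr (3 - \<delta> / 4)" using x \<delta> by (intro powr_mono) auto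
    finally show ?thesis .
  qed
  have "x * x * x * (y * y) \<le> y powr (3 - \<delta> / 4)"
  proof -
    have "real ((s * s) * (s * s)) \<le> y" unfolding xy by (rule of_nat_mono[OF root(1)])
    moreover have "real ((s * s) * (s * s)) = x powr 4" using x by (simp add: xy powr_numeral power4_eq_xxxx)
    ultimately have "(x powr 4) powr (3 / 4) \<le> y powr (3 / 4)" using x by (intro powr_mono2) auto
    then have "x powr 3 \<le> y powr (3 / 4)" unfolding powr_powr by simp
    then have "x powr 3 * y powr 2 \<le> y powr (3 / 4) * y powr 2" by (intro mult_right_mono) auto
    also have "\<dots> = y powr (11 / 4)" by (simp add: powr_add[symmetric])
    \<comment> \<open>The inequality 11/4 \<le> 3 - \<delta>/4 is again \<delta> \<le> 1.\<close>
    also have "\<dots> \<le> y powr (3 - \<delta> / 4)" using x \<delta> by (intro powr_mono) auto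
    finally show ?thesis using x by (simp add: powr_numeral power2_eq_square power3_eq_cube)
  qed
  then have "real (b * b * b * (25100 * (s * s) + T\<^sub>P)) + 200 * (y * y) + 300 * (x * x * x * (y * y)) \<le>
      16 * K * y powr (3 - \<delta> / 4) + 200 * y powr (3 - \<delta> / 4) + 300 * y powr (3 - \<delta> / 4)"
    using main y2 by (intro add_mono) auto
  also have "\<dots> = (16 * K + 500) * y powr (3 - \<delta> / 4)" by (simp add: algebra_simps)
  finally show ?thesis by (simp add: xy K_def algebra_simps)
qed

lemma nat_fourth_root:
  assumes "1 \<le> (n::nat)"
  obtains s where "1 \<le> s" "(s * s) * (s * s) \<le> n" "n < ((s + 1) * (s + 1)) * ((s + 1) * (s + 1))"
proof -
  define f :: "nat \<Rightarrow> nat" where "f s = (s * s) * (s * s)" for s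
  have f_ge: "s \<le> f s" for s
    using le_square[of s] le_square[of "s * s"] unfolding f_def by linarith
  then have bounded: "\<forall>s. f s \<le> n \<longrightarrow> s \<le> n" using le_trans by blast
  define s where "s = (GREATEST s. f s \<le> n)"
  have "f 1 \<le> n" using assms by (simp add: f_def)
  then have "f s \<le> n" "1 \<le> s"
    unfolding s_def using bounded GreatestI_nat[of "\<lambda>s. f s \<le> n" 1 n]
      Greatest_le_nat[of "\<lambda>s. f s \<le> n" 1 n] by blast+
  moreover have "\<not> f (s + 1) \<le> n"
  proof
    assume "f (s + 1) \<le> n"
    then have "s + 1 \<le> s" 
      unfolding s_def using bounded Greatest_le_nat[of "\<lambda>s. f s \<le> n" "s + 1" n] unfolding s_def by blast
    then show False by simp
  qed
  ultimately show thesis using that[of s] by (simp add: f_def)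
qed

section \<open>From Check, Boole and Witness to gadgets\<close>

definition gadget_words ::
  "bool \<Rightarrow> nat \<Rightarrow> (nat \<Rightarrow> nat \<Rightarrow> bool) \<Rightarrow> (nat \<Rightarrow> nat \<Rightarrow> bool) \<Rightarrow> (nat \<Rightarrow> nat \<Rightarrow> bool) \<Rightarrow> nat list"
where
  "gadget_words with_nodes s P Q R = (if with_nodes then [4 * s, 4 * s + 1] else []) @
     adjacency_words (gadget_adjacency s P Q R) @ rpq_words (gadget_query s)"

lemma length_gadget_words:
  assumes "1 \<le> s"
  shows "length (gadget_words with_nodes s P Q R) + 2 \<le> 400 * (s * s)"
proof -
  have "length (concat (gadget_adjacency s P Q R)) \<le> (4 * s + 2) * (2 * (4 * s + 2))"
    using length_concat_gadget_adjacency[of "4 * s + 2" s P Q R] by (simp add: length_gadget_adjacency)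
  also have "\<dots> \<le> (6 * s) * (2 * (6 * s))" using assms by (intro mult_le_mono) auto
  finally have "length (concat (gadget_adjacency s P Q R)) \<le> 72 * (s * s)" by simp
  moreover have "length (gadget_words with_nodes s P Q R) \<le>
      2 + (4 * s + 4 + 2 * length (concat (gadget_adjacency s P Q R))) + (10 * s + 9)"
    unfolding gadget_words_def adjacency_words_def flatten_def[symmetric]
    by (simp add: length_flatten length_gadget_adjacency length_rpq_words rpq_length_gadget_query
        del: upt_Suc)
  moreover have "s * 1 \<le> s * s" using assms by (intro mult_le_mono2)
  ultimately show ?thesis using assms by linarith
qed

text \<open>The common consequence of the three assumptions. As in \<open>solves_in_time\<close>,
  one constant \<open>c\<close> is both the exponent of the word bound and the factor of the time
  bound.\<close>

definition decides_gadgets :: "com \<Rightarrow> bool \<Rightarrow> nat \<Rightarrow> real \<Rightarrow> bool" where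
  "decides_gadgets Prog with_nodes c \<epsilon> \<longleftrightarrow> (\<forall>s P Q R. 1 \<le> s \<longrightarrow>
     (\<exists>t st. exec ((length (gadget_words with_nodes s P Q R) + 2) ^ c) Prog
          (initial_state (gadget_words with_nodes s P Q R)) t st \<and>
        real t \<le> real c * (real (4 * s + 2) powr (3 - \<epsilon>) + real (10 * s + 9) powr (3 - \<epsilon>)) \<and>
        snd st 0 = of_bool (\<exists>x<s. \<exists>y<s. \<exists>z<s. P x y \<and> Q y z \<and> R z x)))"

lemma decides_gadgetsI:
  assumes solves: "solves_in_time Prog \<Pi> T"
    and inst: "\<And>s P Q R. 1 \<le> s \<Longrightarrow> i s P Q R \<in> instances \<Pi>"
      "\<And>s P Q R. 1 \<le> s \<Longrightarrow> encodes \<Pi> (i s P Q R) (gadget_words with_nodes s P Q R)"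
      "\<And>s P Q R. 1 \<le> s \<Longrightarrow> T (i s P Q R) = real (4 * s + 2) powr (3 - \<epsilon>) + real (10 * s + 9) powr (3 - \<epsilon>)"
      "\<And>s P Q R m. 1 \<le> s \<Longrightarrow> correct \<Pi> (i s P Q R) m \<Longrightarrow>
        m 0 = of_bool (\<exists>x<s. \<exists>y<s. \<exists>z<s. P x y \<and> Q y z \<and> R z x)"
  shows "\<exists>c. decides_gadgets Prog with_nodes c \<epsilon>"
proof -
  obtain c where c: "\<And>x xs. x \<in> instances \<Pi> \<Longrightarrow> encodes \<Pi> x xs \<Longrightarrow>
      \<exists>t s. exec ((length xs + 2) ^ c) Prog (initial_state xs) t s \<and>
        real t \<le> real c * T x \<and> correct \<Pi> x (snd s)"
    using solves unfolding solves_in_time_def by blast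
  have "decides_gadgets Prog with_nodes c \<epsilon>"
    unfolding decides_gadgets_def
  proof (intro allI impI)
    fix s :: nat and P Q R
    assume s: "1 \<le> s"
    from c[OF inst(1)[OF s] inst(2)[OF s]] obtain t st where
      "exec ((length (gadget_words with_nodes s P Q R) + 2) ^ c) Prog
        (initial_state (gadget_words with_nodes s P Q R)) t st"
      "real t \<le> real c * T (i s P Q R)" "correct \<Pi> (i s P Q R) (snd st)" by blast
    then show "\<exists>t st. exec ((length (gadget_words with_nodes s P Q R) + 2) ^ c) Prog
          (initial_state (gadget_words with_nodes s P Q R)) t st \<and>
        real t \<le> real c * (real (4 * s + 2) powr (3 - \<epsilon>) + real (10 * s + 9) powr (3 - \<epsilon>)) \<and>
        snd st 0 = of_bool (\<exists>x<s. \<exists>y<s. \<exists>z<s. P x y \<and> Q y z \<and> R z x)"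
      using inst(3)[OF s, of P Q R] inst(4)[OF s, of P Q R "snd st"] by metis
  qed
  then show ?thesis ..
qed

text \<open>The pair asked for consists of the entry and the exit of the gadget, the only candidate
  for an answer.\<close>

lemma decides_gadgets_check:
  assumes "2 \<le> \<sigma>" "solves_in_time Prog (check_problem \<sigma>)
    (\<lambda>(D, q, u, v). real (card (nodes D)) powr (3 - \<epsilon>) + real (rpq_length q) powr (3 - \<epsilon>))"
  shows "\<exists>c. decides_gadgets Prog True c \<epsilon>"
proof (rule decides_gadgetsI[OF assms(2), where
      i = "\<lambda>s P Q R. (gadget s P Q R, gadget_query s, 4 * s, 4 * s + 1)"])
  fix s P Q R assume "1 \<le> (s::nat)"
  show "encodes (check_problem \<sigma>) (gadget s P Q R, gadget_query s, 4 * s, 4 * s + 1)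
      (gadget_words True s P Q R)"
    using encodes_db_gadget[of s P Q R] by (auto simp: check_problem_def gadget_words_def)
qed (use assms(1) in \<open>auto simp: check_problem_def db_instance_gadget rpq_over_gadget_query
    nodes_gadget rpq_length_gadget_query answers_gadget\<close>)

lemma decides_gadgets_boole:
  assumes "2 \<le> \<sigma>" "solves_in_time Prog (boole_problem \<sigma>)
    (\<lambda>(D, q). real (card (nodes D)) powr (3 - \<epsilon>) + real (rpq_length q) powr (3 - \<epsilon>))"
  shows "\<exists>c. decides_gadgets Prog False c \<epsilon>"
proof (rule decides_gadgetsI[OF assms(2), where i = "\<lambda>s P Q R. (gadget s P Q R, gadget_query s)"])
  fix s P Q R assume "1 \<le> (s::nat)"
  show "encodes (boole_problem \<sigma>) (gadget s P Q R, gadget_query s) (gadget_words False s P Q R)"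
    using encodes_db_gadget[of s P Q R] by (auto simp: boole_problem_def gadget_words_def)
qed (use assms(1) in \<open>auto simp: boole_problem_def db_instance_gadget rpq_over_gadget_query
    nodes_gadget rpq_length_gadget_query answers_gadget\<close>)

text \<open>A Witness algorithm signals existence in its first output word, which is the Boole
  answer for the same input.\<close>

lemma decides_gadgets_witness:
  assumes "2 \<le> \<sigma>" "solves_in_time Prog (witness_problem \<sigma>)
    (\<lambda>(D, q). real (card (nodes D)) powr (3 - \<epsilon>) + real (rpq_length q) powr (3 - \<epsilon>))"
  shows "\<exists>c. decides_gadgets Prog False c \<epsilon>"
proof (rule decides_gadgetsI[OF assms(2), where i = "\<lambda>s P Q R. (gadget s P Q R, gadget_query s)"])
  fix s P Q R assume "1 \<le> (s::nat)"
  show "encodes (witness_problem \<sigma>) (gadget s P Q R, gadget_query s) (gadget_words False s P Q R)"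
    using encodes_db_gadget[of s P Q R] by (auto simp: witness_problem_def gadget_words_def)
qed (use assms(1) in \<open>auto simp: witness_problem_def db_instance_gadget rpq_over_gadget_query
    nodes_gadget rpq_length_gadget_query answers_gadget split: if_splits\<close>)

section \<open>Assembling the reduction\<close>

lemma matrices_initial_state:
  fixes n A B
  defines "xs \<equiv> n # concat (map (\<lambda>i. map (\<lambda>j. of_bool (A i j)) [0..<n]) [0..<n])
    @ concat (map (\<lambda>i. map (\<lambda>j. of_bool (B i j)) [0..<n]) [0..<n])"
  shows "matrices n A B (\<lambda>_ _. False) (snd (initial_state xs))"
    and "length xs = 1 + n * n + n * n"
    and "small_words (n + 2) (initial_state xs)"
proof -
  let ?rows = "\<lambda>F. concat (map (\<lambda>i. map (\<lambda>j. of_bool (F i j)) [0..<n]) [0..<n]) :: nat list"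
  have len: "length (?rows F) = n * n" for F
    by (simp add: length_concat comp_def sum_list_triv)
  then show length: "length xs = 1 + n * n + n * n" by (simp add: xs_def)
  have nth: "?rows F ! (i * n + j) = of_bool (F i j)" if "i < n" "j < n" for F i j
    using nth_concat_rows(2)[OF that, of "\<lambda>i. map (\<lambda>j. of_bool (F i j)) [0..<n]"] that by simp
  show "matrices n A B (\<lambda>_ _. False) (snd (initial_state xs))"
    unfolding matrices_def
  proof (intro allI impI)
    fix i j assume ij: "i < n" "j < n"
    note less = row_major_less[OF this]
    have "xs ! (1 + i * n + j) = of_bool (A i j)"
      using nth[OF ij] less by (simp add: xs_def nth_append len)
    moreover have "xs ! (1 + n * n + i * n + j) = of_bool (B i j)"
      using nth[OF ij] less by (simp add: xs_def nth_append len)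
    \<comment> \<open>The area of \<open>C\<close> lies behind the input, where memory is 0: the
      search starts from the empty matrix.\<close>
    ultimately show "snd (initial_state xs) (1 + i * n + j) = of_bool (A i j) \<and>
        snd (initial_state xs) (1 + n * n + i * n + j) = of_bool (B i j) \<and>
        snd (initial_state xs) (1 + 2 * n * n + i * n + j) = of_bool False"
      using less by (simp add: initial_state_def length)
  qed
  have "\<forall>w \<in> set xs. w < n + 2" by (auto simp: xs_def)
  then show "small_words (n + 2) (initial_state xs)"
    by (auto simp: small_words_def initial_state_def)
qed

lemma solves_bmm_block_search:
  assumes dec: "decides_gadgets Prog with_nodes c \<epsilon>" and \<delta>: "0 < \<delta>" "\<delta> \<le> 1" "\<delta> \<le> \<epsilon>"
  shows "solves_in_time (block_search with_nodes Prog) bmm_problem (\<lambda>(n, A, B). real n powr (3 - \<delta> / 4))"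
proof -
  \<comment> \<open>The summands serve three purposes: 5000 for \<open>?M ^ 1000\<close> with
    \<open>?M \<le> X ^ 5\<close>, \<open>5 * c\<close> for the word bound of the subroutine, whose
    input length plus 2 is at most \<open>X ^ 5\<close>, and the rest is the constant of
    \<open>block_search_time\<close>.\<close>
  define c' where "c' = 5000 + 5 * c + (16 * (25100 + 13718 * c) + 500)"
  have "\<exists>t st. exec ((length xs + 2) ^ c') (block_search with_nodes Prog) (initial_state xs) t st \<and>
      real t \<le> real c' * real n powr (3 - \<delta> / 4) \<and> correct bmm_problem (n, A, B) (snd st)"
    if n: "1 \<le> n" and xs: "xs = n # concat (map (\<lambda>i. map (\<lambda>j. of_bool (A i j)) [0..<n]) [0..<n])
      @ concat (map (\<lambda>i. map (\<lambda>j. of_bool (B i j)) [0..<n]) [0..<n])" for n A B xs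
  proof -
    obtain s where root: "1 \<le> s" "(s * s) * (s * s) \<le> n" "n < ((s + 1) * (s + 1)) * ((s + 1) * (s + 1))"
      using nat_fourth_root[OF n] .
    note init = matrices_initial_state[of n A B, folded xs]
    have sn: "s \<le> n" using root(2) le_square[of s] le_square[of "s * s"] by linarith
    define X where "X = length xs + 2"
    have X: "X = 3 + 2 * (n * n)" by (simp add: X_def init(2))
    have nn: "n * 1 \<le> n * n" using n by (intro mult_le_mono2)
    have "5 \<le> X" using nn n X by linarith
    \<comment> \<open>Four factors \<open>X\<close>, each at least 5, give 625, and the fifth
      exceeds \<open>2 * (n * n)\<close>.\<close>
    have "1000 * (n * n) \<le> X ^ 5"
    proof -
      have "5 ^ 4 \<le> X ^ 4" using \<open>5 \<le> X\<close> by (rule power_mono) simp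
      then have "5 ^ 4 * X \<le> X ^ 4 * X" by (rule mult_le_mono1)
      also have "X ^ 4 * X = X ^ 5" by (simp add: power_Suc2[symmetric] del: power_Suc2 power_Suc)
      finally show ?thesis using X by simp
    qed
    note X5 = this
    \<comment> \<open>The locale wants a natural number; rounding down is safe because running times
      are natural numbers.\<close>
    define T where "T = nat \<lfloor>real c * (real (4 * s + 2) powr (3 - \<epsilon>) + real (10 * s + 9) powr (3 - \<epsilon>))\<rfloor>"
    have T: "real T \<le> real c * (real (4 * s + 2) powr (3 - \<epsilon>) + real (10 * s + 9) powr (3 - \<epsilon>))"
      unfolding T_def by (intro of_nat_floor mult_nonneg_nonneg add_nonneg_nonneg) auto
    let ?M = "1000 * (n * n)"
    interpret solver "X ^ c'" ?M n s "1 + 3 * n * n" A B Prog with_nodes T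
    proof unfold_locales
      show "10 \<le> ?M" using nn n by linarith
      have "?M ^ 1000 \<le> (X ^ 5) ^ 1000" using X5 by (rule power_mono) simp
      also have "\<dots> = X ^ 5000" by (simp add: power_mult[symmetric])
      also have "\<dots> \<le> X ^ c'" using \<open>5 \<le> X\<close> by (intro power_increasing) (auto simp: c'_def)
      finally show "?M ^ 1000 \<le> X ^ c'" .
    next
      fix P Q R
      obtain t st where st: "exec ((length (gadget_words with_nodes s P Q R) + 2) ^ c) Prog
            (initial_state (gadget_words with_nodes s P Q R)) t st"
          "real t \<le> real c * (real (4 * s + 2) powr (3 - \<epsilon>) + real (10 * s + 9) powr (3 - \<epsilon>))"
          "snd st 0 = of_bool (\<exists>x<s. \<exists>y<s. \<exists>z<s. P x y \<and> Q y z \<and> R z x)"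
        using dec root(1) unfolding decides_gadgets_def by meson
      have "length (gadget_words with_nodes s P Q R) + 2 \<le> X ^ 5"
      proof -
        have "s * s \<le> n * n" using sn by (intro mult_le_mono)
        then show ?thesis using length_gadget_words[OF root(1), of with_nodes P Q R] X5 by linarith
      qed
      then have "(length (gadget_words with_nodes s P Q R) + 2) ^ c \<le> (X ^ 5) ^ c"
        by (rule power_mono) simp
      also have "\<dots> = X ^ (5 * c)" by (simp add: power_mult)
      also have "\<dots> \<le> X ^ c'" using \<open>5 \<le> X\<close> by (intro power_increasing) (auto simp: c'_def)
      finally have "exec (X ^ c') Prog (initial_state (gadget_words with_nodes s P Q R)) t st"
        by (rule exec_mono[OF st(1)])
      moreover have "t \<le> T" unfolding T_def using st(2) by (rule le_nat_floor)
      moreover have "snd st 0 \<le> 1" unfolding st(3) by simp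
      then have "snd st 0 < ?M" using nn n by linarith
      moreover have "snd st 0 \<noteq> 0 \<longleftrightarrow> (\<exists>x<s. \<exists>y<s. \<exists>z<s. P x y \<and> Q y z \<and> R z x)"
        unfolding st(3) by (simp only: of_bool_eq_0_iff not_not)
      ultimately show "\<exists>t s'. exec (X ^ c') Prog (initial_state ((if with_nodes then [4 * s, 4 * s + 1] else []) @
          adjacency_words (gadget_adjacency s P Q R) @ rpq_words (gadget_query s))) t s' \<and>
        t \<le> T \<and> snd s' 0 < ?M \<and> (snd s' 0 \<noteq> 0 \<longleftrightarrow> (\<exists>x<s. \<exists>y<s. \<exists>z<s. P x y \<and> Q y z \<and> R z x))"
        unfolding gadget_words_def[symmetric] by (intro exI[of _ t] exI[of _ st] conjI)
    qed (use root sn in auto)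
    let ?b = "n div s + 1"
    have "n + 2 \<le> ?M" using nn n by linarith
    with init(3) have "small_words ?M (initial_state xs)" by (rule small_words_mono)
    moreover have "run fill (block_search with_nodes Prog) (initial_state xs)
      (?b * ?b * ?b * (25100 * (s * s) + T) + 200 * (n * n))
      (\<lambda>st'. \<forall>i<n. \<forall>j<n. snd st' (i * n + j) = of_bool (\<exists>k<n. A i k \<and> B k j))"
      by (rule run_block_search) (use init in \<open>auto simp: initial_state_def xs\<close>)
    ultimately obtain t st where st: "exec (X ^ c') (block_search with_nodes Prog) (initial_state xs) t st"
        "t + fill st \<le> ?b * ?b * ?b * (25100 * (s * s) + T) + 200 * (n * n)
          + fill (initial_state xs)"
        "\<forall>i<n. \<forall>j<n. snd st (i * n + j) = of_bool (\<exists>k<n. A i k \<and> B k j)"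
      unfolding run_def by blast
    \<comment> \<open>The initial potential, at most one search per entry of the product, pays for
      all searches.\<close>
    have "t \<le> ?b * ?b * ?b * (25100 * (s * s) + T) + 200 * (n * n) + 300 * (s * s * s) * (n * n)"
      using st(2) unfilled_le[of "300 * (s * s * s)" "initial_state xs"] by linarith
    then have "real t \<le> real (?b * ?b * ?b * (25100 * (s * s) + T) + 200 * (n * n) +
        300 * (s * s * s) * (n * n))" by (rule of_nat_mono)
    also have "\<dots> \<le> real (16 * (25100 + 13718 * c) + 500) * real n powr (3 - \<delta> / 4)"
      by (rule block_search_time[OF root \<delta> T])
    also have "\<dots> \<le> real c' * real n powr (3 - \<delta> / 4)"
      by (intro mult_right_mono of_nat_mono) (simp_all add: c'_def)
    finally show ?thesis
      using st(1,3) unfolding X_def by (intro exI[of _ t] exI[of _ st]) (simp add: bmm_problem_def)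
  qed
  then show ?thesis
    unfolding solves_in_time_def by (intro exI[of _ c']) (auto simp: bmm_problem_def)
qed

theorem theorem5p6:
  fixes \<sigma> :: nat and comb :: "com \<Rightarrow> bool"
  assumes "2 \<le> \<sigma>"
    and "admissible_combinatorial comb"
    and "\<exists>\<epsilon>>0. \<exists>P. comb P \<and>
      (solves_in_time P (check_problem \<sigma>)
         (\<lambda>(D, q, u, v). real (card (nodes D)) powr (3 - \<epsilon>) + real (rpq_length q) powr (3 - \<epsilon>)) \<or>
       solves_in_time P (boole_problem \<sigma>)
         (\<lambda>(D, q). real (card (nodes D)) powr (3 - \<epsilon>) + real (rpq_length q) powr (3 - \<epsilon>)) \<or>
       solves_in_time P (witness_problem \<sigma>)
         (\<lambda>(D, q). real (card (nodes D)) powr (3 - \<epsilon>) + real (rpq_length q) powr (3 - \<epsilon>)))"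
  shows "\<not> combinatorial_BMM_hypothesis comb"
proof -
  \<comment> \<open>The three cases differ only in \<open>with_nodes\<close>: true for Check, false
    for Boole and Witness.\<close>
  obtain \<epsilon> P where \<epsilon>: "\<epsilon> > 0" and P: "comb P" and "\<exists>with_nodes c. decides_gadgets P with_nodes c \<epsilon>"
    using assms(3) decides_gadgets_check[OF assms(1)] decides_gadgets_boole[OF assms(1)]
      decides_gadgets_witness[OF assms(1)] by metis
  then obtain with_nodes c where "decides_gadgets P with_nodes c \<epsilon>" by blast
  then have "solves_in_time (block_search with_nodes P) bmm_problem
      (\<lambda>(n, A, B). real n powr (3 - min \<epsilon> 1 / 4))"
    using \<epsilon> by (intro solves_bmm_block_search) auto
  moreover have "comb (block_search with_nodes P)"
    using assms(2) P by (simp add: admissible_combinatorial_def)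
  moreover have "min \<epsilon> 1 / 4 > 0" using \<epsilon> by simp
  ultimately show ?thesis unfolding combinatorial_BMM_hypothesis_def by blast
qed

end
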